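(* Let $m\ge1$, let $X=(X_1,\dots,X_{m+1})$ be multivariate log-normal, $X_i=\exp(Z_i)$ with $Z\sim\mathcal{N}_{m+1}(\mu,A)$, where $\mu\in\mathbb{R}^{m+1}$ and $A$ is symmetric positive definite with inverse $B=A^{-1}$. Put $b_i=\sum_{j=1}^{m+1}B_{ji}$ and $\beta=\sum_{i=1}^{m+1}b_i$, and assume $b_k>0$ for $k=1,\dots,m+1$. For $\varepsilon>0$ let $\mathcal{U}_m^\varepsilon=\{t\in\mathbb{R}^m:t_i\ge\varepsilon\ (i=1,\dots,m),\ \sum_{i=1}^mt_i\le1-\varepsilon\}$ and $\gamma(t)=(t_1,\dots,t_m,1-\sum_{i=1}^mt_i)$. Then for every sufficiently small $\varepsilon>0$ the following hold. For all sufficiently small $\alpha>0$ the function $q_\alpha$ has a unique maximizer $u_\alpha^*=\gamma(t_\alpha^* )$ on $\gamma(\mathcal{U}_m^\varepsilon)$; as $\alpha\to0$, $$\lim_{\alpha\to0}t_\alpha^*=\Big(\frac{b_i}{\beta}\Big)_{i=1}^m;$$ and for every $t\in\mathcal{U}_m^\varepsilon$, with $k_\alpha=q_\alpha(u_\alpha^* )$, $$q_\alpha(\gamma(t))\sim k_\alpha\,q_0(t)\quad\text{as }\alpha\to0,$$ where $$q_0(t_1,\dots,t_m)=\exp\Big(\frac1\beta\Big(\sum_{i=1}^mb_i\log\Big(\frac{\beta t_i}{b_i}\Big)+b_{m+1}\log\Big(\frac{\beta\,(1-\sum_{i=1}^mt_i)}{b_{m+1}}\Big)\Big)\Big).$$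
   Context: For $\alpha\in(0,1)$ and $u\in(0,\infty)^{m+1}$, $q_\alpha(u)=\inf\{y\in\mathbb{R}:P(\sum_{i=1}^{m+1}u_iX_i\le y)\ge\alpha\}$. The notation $f(\alpha)\sim g(\alpha)$ as $\alpha\to0$ means $f(\alpha)/g(\alpha)\to1$. *)

theory Defs
  imports "HOL-Probability.Probability"
begin

definition sym_pos_def :: "real ^ 'n ^ 'n \<Rightarrow> bool" where
  "sym_pos_def A \<longleftrightarrow> transpose A = A \<and> (\<forall>x. x \<noteq> 0 \<longrightarrow> x \<bullet> (A *v x) > 0)"

definition mvn_density :: "real ^ 'n \<Rightarrow> real ^ 'n ^ 'n \<Rightarrow> real ^ 'n \<Rightarrow> real" where
  "mvn_density \<mu> A z =
     exp (- ((z - \<mu>) \<bullet> (matrix_inv A *v (z - \<mu>))) / 2) / sqrt ((2 * pi) ^ CARD('n) * det A)"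

text \<open>The law \<open>N(\<mu>, A)\<close>, given by its Lebesgue density; this requires \<open>A\<close> to be nondegenerate.\<close>

definition multivariate_normal ::
  "'a measure \<Rightarrow> ('a \<Rightarrow> real ^ 'n) \<Rightarrow> real ^ 'n \<Rightarrow> real ^ 'n ^ 'n \<Rightarrow> bool" where
  "multivariate_normal M Z \<mu> A \<longleftrightarrow>
     sym_pos_def A \<and> distributed M lborel Z (\<lambda>z. ennreal (mvn_density \<mu> A z))"

definition portfolio_quantile ::
  "'a measure \<Rightarrow> ('a \<Rightarrow> real ^ 'n) \<Rightarrow> real \<Rightarrow> real ^ 'n \<Rightarrow> real" where
  "portfolio_quantile M X \<alpha> u =
     Inf {y. measure M {\<omega> \<in> space M. (\<Sum>i\<in>UNIV. u $ i * X \<omega> $ i) \<le> y} \<ge> \<alpha>}"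

text \<open>
  For an index type \<open>'m\<close> with \<open>m\<close> elements, the \<open>m + 1\<close> coordinates are indexed by \<open>'m option\<close>:
  \<open>Some i\<close> is the coordinate \<open>i \<le> m\<close> and \<open>None\<close> is the coordinate \<open>m + 1\<close>.
\<close>

definition simplex_param :: "real ^ 'm \<Rightarrow> real ^ 'm option" where
  "simplex_param t = (\<chi> j. case j of Some i \<Rightarrow> t $ i | None \<Rightarrow> 1 - (\<Sum>i\<in>UNIV. t $ i))"

definition trunc_simplex :: "real \<Rightarrow> (real ^ 'm) set" where
  "trunc_simplex \<epsilon> = {t. (\<forall>i. t $ i \<ge> \<epsilon>) \<and> (\<Sum>i\<in>UNIV. t $ i) \<le> 1 - \<epsilon>}"

definition limit_profile :: "real ^ 'm option \<Rightarrow> real \<Rightarrow> real ^ 'm \<Rightarrow> real" where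
  "limit_profile b \<beta> t =
     exp (1 / \<beta> * ((\<Sum>i\<in>UNIV. b $ Some i * ln (\<beta> * t $ i / b $ Some i))
       + b $ None * ln (\<beta> * (1 - (\<Sum>i\<in>UNIV. t $ i)) / b $ None)))"

end

(*
  Since b = B 1 and beta is the sum of the b_i, shifting the law of Z by ln y 1 gives, for y = exp (-l),
  P(S_u <= y) = exp (- l (b . theta) - l^2 beta / 2) * I(l, theta), theta = ln u + mu, where
  I(l, theta) is the integral of exp (l (b . v)) times the density of N(0, A) at v - theta, over
  v with sum_i exp v_i <= 1.  On that region b . v is at most a negative multiple of |v|, so the
  mean of |v| under the tilted law stays bounded as l grows.

  Jensen's inequality then shows that I(l, theta) varies by bounded factors only, for theta in a
  compact set.  Hence ln q_alpha(u) - ln q_alpha(u') tends to b . (ln u - ln u') / beta uniformly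
  on the truncated simplex.  By Gibbs' inequality the limit profile peaks at u = b / beta only.

  The maximizers of q_alpha are the minimizers of u |-> P(S_u <= k), k = max q_alpha.  Because
  - l (b . ln u) is strongly convex in u with constant of order l, while the rest of the exponent
  has bounded second differences on average, this function satisfies strict midpoint convexity
  for small k, which gives uniqueness.
*)

theory Submission
  imports Defs
begin

text \<open>Uniform convergence of the differences of \<open>ln (q \<alpha> u)\<close> locates the
  maximizers but cannot count them, since a perturbation that is small in the sup norm may create
  several maxima; this is why a separate second order estimate at each small level is required. It
  is obtained without differentiating anything, from finite differences under an integral. The
  direction \<open>1\<close> is singled out because changing \<open>y\<close> translates all
  coordinates of \<open>Z\<close> by the same amount, and \<open>B *v 1 = b\<close> turns the mixed
  term of the quadratic form into the linear functional \<open>b \<bullet> v\<close>. Positivity of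
  \<open>b\<close> lets this functional control \<open>norm v\<close> on the region. Every constant
  has to be independent of \<open>l\<close>; this comes from comparing the tilt \<open>l\<close>
  with the tilt 1.\<close>

definition exp_region :: "(real ^ 'n) set" where
  "exp_region = {v. (\<Sum>i\<in>UNIV. exp (v $ i)) \<le> 1}"

definition ln_vec :: "real ^ 'n \<Rightarrow> real ^ 'n" where
  "ln_vec u = (\<chi> i. ln (u $ i))"

lemma ln_vec_nth [simp]: "ln_vec u $ i = ln (u $ i)"
  by (simp add: ln_vec_def)

lemma exp_region_neg:
  assumes "v \<in> exp_region" shows "v $ i \<le> 0"
proof -
  have "exp (v $ i) \<le> (\<Sum>i\<in>UNIV. exp (v $ i))"
    by (rule member_le_sum) auto
  also have "\<dots> \<le> 1" using assms by (simp add: exp_region_def)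
  finally show ?thesis by simp
qed

lemma exp_region_measurable [measurable]: "exp_region \<in> sets (borel :: (real ^ 'n) measure)"
proof -
  have "closed (exp_region :: (real ^ 'n) set)"
    unfolding exp_region_def by (intro closed_Collect_le continuous_intros)
  then show ?thesis by simp
qed

lemma integrable_lborel_translation:
  fixes f :: "'a::euclidean_space \<Rightarrow> real"
  assumes "integrable lborel f"
  shows "integrable lborel (\<lambda>v. f (v - x))"
proof -
  have "integrable lborel (\<lambda>v. f (- x + v))"
    by (rule integrable_distr[of "(+) (- x)" lborel borel])
      (use assms in \<open>simp_all add: lborel_distr_plus\<close>)
  then show ?thesis by simp
qed

lemma integral_lborel_translation:
  fixes f :: "'a::euclidean_space \<Rightarrow> real"
  assumes "integrable lborel f"
  shows "(\<integral>v. f (v - x) \<partial>lborel) = (\<integral>v. f v \<partial>lborel)"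
proof -
  have "(\<integral>v. f v \<partial>distr lborel borel ((+) (- x))) = (\<integral>v. f (- x + v) \<partial>lborel)"
    by (rule integral_distr) (use assms in auto)
  then show ?thesis by (simp add: lborel_distr_plus)
qed

section \<open>The Gaussian density and its exponential tilts\<close>

text \<open>The analytic part is stated for the precision matrix \<open>B\<close> alone.
  Normalisation is an assumption here; \<open>lognormal_portfolioI\<close> reads it off the law of
  \<open>Z\<close>, which saves evaluating a Gaussian integral.\<close>

locale gaussian_density =
  fixes B :: "real ^ 'n ^ 'n" and b :: "real ^ 'n" and c :: real
  assumes B_sym: "transpose B = B"
    and b_eq: "B *v 1 = b"
    and b_pos: "b $ i > 0"
    and c_pos: "c > 0"
    and total: "(\<integral>\<^sup>+z. ennreal (c * exp (- (z \<bullet> (B *v z)) / 2)) \<partial>lborel) = 1"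
begin

definition dens :: "real ^ 'n \<Rightarrow> real" where
  "dens z = c * exp (- (z \<bullet> (B *v z)) / 2)"

definition tot :: real where "tot = (\<Sum>i\<in>UNIV. b $ i)"

definition bmin :: real where "bmin = Min (range (($) b))"

definition K :: real where "K = onorm ((*v) B)"

lemma dens_pos: "dens z > 0"
  by (simp add: dens_def c_pos)

lemma tot_pos: "tot > 0"
  unfolding tot_def by (rule sum_pos) (auto simp: b_pos)

lemma bmin_pos: "bmin > 0"
  unfolding bmin_def by (subst Min_gr_iff) (auto simp: b_pos)

lemma bmin_le: "bmin \<le> b $ i"
  unfolding bmin_def by (rule Min_le) auto

lemma K_nonneg: "K \<ge> 0"
  unfolding K_def by (rule onorm_pos_le) (rule matrix_vector_mul_bounded_linear)

lemma bilinear_le: "\<bar>x \<bullet> (B *v y)\<bar> \<le> K * norm x * norm y"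
proof -
  have "\<bar>x \<bullet> (B *v y)\<bar> \<le> norm x * norm (B *v y)" by (rule Cauchy_Schwarz_ineq2)
  also have "\<dots> \<le> norm x * (K * norm y)" unfolding K_def
    by (intro mult_left_mono onorm matrix_vector_mul_bounded_linear) auto
  finally show ?thesis by (simp add: mult_ac)
qed

lemma bilinear_sym: "x \<bullet> (B *v y) = y \<bullet> (B *v x)"
  by (metis B_sym dot_lmul_matrix inner_commute transpose_matrix_vector)

lemma inner_one: "1 \<bullet> (B *v x) = b \<bullet> x"
  by (metis b_eq bilinear_sym inner_commute)

lemma one_one: "1 \<bullet> (B *v 1) = tot"
  by (simp add: b_eq tot_def inner_vec_def)

lemma b_inner_one: "b \<bullet> 1 = tot"
  by (simp add: tot_def inner_vec_def)

lemma dens_shift: "dens (x + d) = dens x * exp (- (d \<bullet> (B *v x)) - (d \<bullet> (B *v d)) / 2)"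
proof -
  have "(x + d) \<bullet> (B *v (x + d)) = x \<bullet> (B *v x) + 2 * (d \<bullet> (B *v x)) + d \<bullet> (B *v d)"
    by (simp add: matrix_vector_right_distrib inner_add_left inner_add_right bilinear_sym[of x d])
  then show ?thesis
    unfolding dens_def mult.assoc exp_add[symmetric] by (simp add: field_simps)
qed

lemma dens_shift_one:
  "dens (x - l *\<^sub>R 1) = dens x * exp (l * (b \<bullet> x) - l\<^sup>2 * tot / 2)"
  using dens_shift[of x "(- l) *\<^sub>R 1"]
  unfolding matrix_vector_mult_scaleR inner_scaleR_left inner_scaleR_right inner_one one_one
  by (simp add: power2_eq_square b_inner_one)

lemma dens_measurable [measurable]: "dens \<in> borel_measurable borel"
proof -
  have "continuous_on UNIV dens"
    unfolding dens_def by (intro continuous_intros matrix_vector_mult_linear_continuous_on) simp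
  then show ?thesis by (rule borel_measurable_continuous_onI)
qed

lemma dens_integrable: "integrable lborel dens"
  by (rule integrableI_nonneg) (use dens_pos total in \<open>auto simp: dens_def less_imp_le\<close>)

lemma dens_integral: "(\<integral>z. dens z \<partial>lborel) = 1"
  by (subst integral_eq_nn_integral) (use dens_pos total in \<open>auto simp: dens_def less_imp_le\<close>)

text \<open>For a vector \<open>G\<close> with density \<open>dens\<close> this is the probability
  that \<open>x + G\<close> falls into \<open>exp_region\<close>. It is the distribution function of
  the portfolio in logarithmic coordinates, see \<open>F_eq_H\<close>.\<close>

definition H :: "real ^ 'n \<Rightarrow> real" where
  "H x = (\<integral>v. indicator exp_region v * dens (v - x) \<partial>lborel)"

text \<open>The integrand of \<open>H (\<theta> + l *\<^sub>R 1)\<close> after division by the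
  factor that is constant in \<open>v\<close> (\<open>integrand_eq\<close>). What remains of
  \<open>l\<close> is an exponential tilt along \<open>b\<close>.\<close>

definition W :: "real \<Rightarrow> real ^ 'n \<Rightarrow> real ^ 'n \<Rightarrow> real" where
  "W l \<theta> v = indicator exp_region v * exp (l * (b \<bullet> v)) * dens (v - \<theta>)"

lemma W_nonneg: "W l \<theta> v \<ge> 0"
  using dens_pos[of "v - \<theta>"] by (simp add: W_def)

lemma W_measurable [measurable]: "W l \<theta> \<in> borel_measurable borel"
  unfolding W_def by measurable

text \<open>Moving the centre of the Gaussian multiplies the density by the exponential of an affine
  function of \<open>v\<close>, whose coefficients are bounded by multiples of the displacement. The
  tilt does not see the centre, so the factor is free of \<open>l\<close>.\<close>

lemma W_pointwise_ge:
  assumes "norm \<theta> \<le> R" "norm \<theta>' \<le> R"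
  shows "W l \<theta> v \<ge> exp (- (K * norm (\<theta> - \<theta>')) * norm v - 2 * R * K * norm (\<theta> - \<theta>')) * W l \<theta>' v"
proof -
  let ?d = "\<theta>' - \<theta>" and ?s = "K * norm (\<theta> - \<theta>')"
  have s: "?s \<ge> 0" using K_nonneg by simp
  have nd: "norm ?d \<le> 2 * R" using norm_triangle_ineq4[of \<theta>' \<theta>] assms by linarith
  have "?d \<bullet> (B *v (v - \<theta>')) \<le> K * norm ?d * norm (v - \<theta>')"
    using bilinear_le[of ?d "v - \<theta>'"] by linarith
  also have "\<dots> \<le> ?s * (norm v + R)"
    using norm_triangle_ineq4[of v \<theta>'] assms s
    by (auto intro!: mult_left_mono simp: norm_minus_commute)
  finally have 1: "?d \<bullet> (B *v (v - \<theta>')) \<le> ?s * norm v + ?s * R" by (simp add: algebra_simps)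
  have "?d \<bullet> (B *v ?d) \<le> K * norm ?d * norm ?d"
    using bilinear_le[of ?d ?d] by linarith
  also have "\<dots> \<le> ?s * (2 * R)"
    using nd s by (auto intro!: mult_left_mono simp: norm_minus_commute)
  finally have 2: "?d \<bullet> (B *v ?d) \<le> ?s * (2 * R)" .
  have "exp (- ?s * norm v - 2 * R * K * norm (\<theta> - \<theta>')) * dens (v - \<theta>')
      \<le> exp (- (?d \<bullet> (B *v (v - \<theta>'))) - (?d \<bullet> (B *v ?d)) / 2) * dens (v - \<theta>')"
  proof (intro mult_right_mono)
    have "2 * R * K * norm (\<theta> - \<theta>') = 2 * (?s * R)" "?s * (2 * R) = 2 * (?s * R)"
      "- ?s * norm v = - (?s * norm v)" by simp_all
    with 1 2 have "- ?s * norm v - 2 * R * K * norm (\<theta> - \<theta>') \<le> - (?d \<bullet> (B *v (v - \<theta>'))) - (?d \<bullet> (B *v ?d)) / 2"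
      by linarith
    then show "exp (- ?s * norm v - 2 * R * K * norm (\<theta> - \<theta>'))
        \<le> exp (- (?d \<bullet> (B *v (v - \<theta>'))) - (?d \<bullet> (B *v ?d)) / 2)" by (simp only: exp_le_cancel_iff)
  qed (use dens_pos[of "v - \<theta>'"] in simp)
  also have "\<dots> = dens (v - \<theta>)" using dens_shift[of "v - \<theta>'" ?d] by simp
  finally show ?thesis
    unfolding W_def by (auto simp: indicator_def mult.left_commute intro!: mult_left_mono)
qed

lemma integrand_eq:
  "indicator exp_region v * dens (v - (\<theta> + l *\<^sub>R 1)) = exp (- l * (b \<bullet> \<theta>) - l\<^sup>2 * tot / 2) * W l \<theta> v"
proof -
  have "dens (v - (\<theta> + l *\<^sub>R 1)) = dens (v - \<theta>) * exp (l * (b \<bullet> (v - \<theta>)) - l\<^sup>2 * tot / 2)"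
    using dens_shift_one[of "v - \<theta>" l] by (simp add: algebra_simps)
  also have "\<dots> = exp (- l * (b \<bullet> \<theta>) - l\<^sup>2 * tot / 2) * (exp (l * (b \<bullet> v)) * dens (v - \<theta>))"
    by (simp add: inner_diff_right algebra_simps flip: exp_add)
  finally show ?thesis by (simp add: W_def)
qed

lemma H_eq: "H (\<theta> + l *\<^sub>R 1) = exp (- l * (b \<bullet> \<theta>) - l\<^sup>2 * tot / 2) * (\<integral>v. W l \<theta> v \<partial>lborel)"
  unfolding H_def integrand_eq by simp

section \<open>Mass and mean of the tilted density\<close>

text \<open>All coordinates are nonpositive on the region, so \<open>- (b \<bullet> v)\<close> is a
  weighted l1 norm with weights at least \<open>bmin\<close>, and the l1 norm dominates the
  Euclidean one.\<close>

lemma norm_le_on_region: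
  assumes "v \<in> exp_region" shows "bmin * norm v \<le> - (b \<bullet> v)"
proof -
  have "bmin * norm v \<le> bmin * (\<Sum>i\<in>UNIV. \<bar>v $ i\<bar>)"
    using bmin_pos norm_le_l1_cart[of v] by simp
  also have "\<dots> \<le> (\<Sum>i\<in>UNIV. b $ i * (- v $ i))"
    unfolding sum_distrib_left using exp_region_neg[OF assms] bmin_le b_pos bmin_pos
    by (intro sum_mono mult_mono) (auto simp: less_imp_le)
  finally show ?thesis by (simp add: inner_vec_def sum_negf)
qed

lemma b_inner_nonpos:
  assumes "v \<in> exp_region" shows "b \<bullet> v \<le> 0"
proof -
  have "0 \<le> bmin * norm v" using bmin_pos by simp
  then show ?thesis using norm_le_on_region[OF assms] by linarith
qed

lemma W_le_dens: assumes "l \<ge> 0" shows "W l \<theta> v \<le> dens (v - \<theta>)"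
  using b_inner_nonpos[of v] dens_pos[of "v - \<theta>"] assms
  by (auto simp: W_def indicator_def mult_le_cancel_right1 mult_nonneg_nonpos)

lemma W_integrable: assumes "l \<ge> 0" shows "integrable lborel (W l \<theta>)"
  by (rule Bochner_Integration.integrable_bound[OF integrable_lborel_translation[OF dens_integrable, of \<theta>]])
    (use W_le_dens[OF assms] W_nonneg dens_pos in \<open>auto simp: abs_of_pos\<close>)

text \<open>On the region, \<open>X = - (b \<bullet> v)\<close> satisfies
  \<open>X * exp (- l * X) \<le> X * exp (- X) \<le> 1\<close>. This yields integrability for every
  \<open>l \<ge> 1\<close> and, at \<open>l = 1\<close>, the bound 1 on the integral that starts
  \<open>mean_bounded\<close>.\<close>

lemma weighted_W_le_dens:
  assumes "l \<ge> 1" shows "- (b \<bullet> v) * W l \<theta> v \<le> dens (v - \<theta>)"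
proof (cases "v \<in> exp_region")
  case True
  let ?X = "- (b \<bullet> v)"
  have X: "?X \<ge> 0" using b_inner_nonpos[OF True] by simp
  have "?X * exp (l * (b \<bullet> v)) \<le> ?X * exp (- ?X)"
    using X mult_right_mono[OF assms X] by (intro mult_left_mono) auto
  also have "\<dots> \<le> exp ?X * exp (- ?X)"
    using exp_ge_add_one_self[of ?X] by (intro mult_right_mono) auto
  also have "\<dots> = 1" by (simp flip: exp_add)
  finally have "?X * exp (l * (b \<bullet> v)) * dens (v - \<theta>) \<le> 1 * dens (v - \<theta>)"
    using dens_pos[of "v - \<theta>"] by (intro mult_right_mono) auto
  then show ?thesis using True by (simp add: W_def mult.assoc)
next
  case False
  then show ?thesis using dens_pos[of "v - \<theta>"] by (simp add: W_def)
qed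

lemma weighted_W_nonneg: "- (b \<bullet> v) * W l \<theta> v \<ge> 0"
proof (cases "v \<in> exp_region")
  case True
  then show ?thesis using b_inner_nonpos[OF True] W_nonneg[of l \<theta> v] by (simp add: mult_nonpos_nonneg)
qed (simp add: W_def)

lemma weighted_W_integrable:
  assumes "l \<ge> 1" shows "integrable lborel (\<lambda>v. - (b \<bullet> v) * W l \<theta> v)"
proof (rule Bochner_Integration.integrable_bound[OF integrable_lborel_translation[OF dens_integrable, of \<theta>]])
  show "AE v in lborel. norm (- (b \<bullet> v) * W l \<theta> v) \<le> norm (dens (v - \<theta>))"
    using weighted_W_le_dens[OF assms] weighted_W_nonneg[of _ l \<theta>] dens_pos
    by (intro AE_I2) (metis abs_of_nonneg abs_of_pos real_norm_def)
qed measurable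

lemma norm_W_le: "norm v * W l \<theta> v \<le> (1 / bmin) * (- (b \<bullet> v) * W l \<theta> v)"
proof (cases "v \<in> exp_region")
  case True
  have "norm v \<le> (1 / bmin) * (- (b \<bullet> v))"
    using norm_le_on_region[OF True] bmin_pos by (simp add: field_simps)
  from mult_right_mono[OF this W_nonneg[of l \<theta> v]] show ?thesis by (simp add: mult_ac)
qed (simp add: W_def)

lemma norm_W_integrable:
  assumes "l \<ge> 1" shows "integrable lborel (\<lambda>v. norm v * W l \<theta> v)"
proof (rule Bochner_Integration.integrable_bound[OF integrable_mult_right[OF weighted_W_integrable[OF assms, of \<theta>], of "1 / bmin"]])
  show "AE v in lborel. norm (norm v * W l \<theta> v) \<le> norm (1 / bmin * (- (b \<bullet> v) * W l \<theta> v))"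
  proof (rule AE_I2)
    fix v :: "real ^ 'n"
    have "norm (norm v * W l \<theta> v) = norm v * W l \<theta> v"
      using W_nonneg[of l \<theta> v] by simp
    also have "\<dots> \<le> (1 / bmin) * (- (b \<bullet> v) * W l \<theta> v)" by (rule norm_W_le)
    also have "\<dots> \<le> norm (1 / bmin * (- (b \<bullet> v) * W l \<theta> v))" unfolding real_norm_def by (rule abs_ge_self)
    finally show "norm (norm v * W l \<theta> v) \<le> norm (1 / bmin * (- (b \<bullet> v) * W l \<theta> v))" .
  qed
qed measurable

lemma W_integral_bounded_below:
  "\<exists>c1>0. \<forall>\<theta>. norm \<theta> \<le> R \<longrightarrow> (\<integral>v. W 1 \<theta> v \<partial>lborel) \<ge> c1"
proof -
  \<comment> \<open>Within distance 1 of \<open>p\<close> every coordinate is at most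
    \<open>- ln (real CARD('n))\<close>, so the exponentials sum to at most 1 and the unit ball lies
    in the region.\<close>
  define p :: "real ^ 'n" where "p = - (ln (real CARD('n)) + 1) *\<^sub>R 1"
  define r where "r = norm p + 1"
  define c2 where "c2 = exp (- (norm b * r)) * (c * exp (- (K * (r + \<bar>R\<bar>) * (r + \<bar>R\<bar>)) / 2))"
  have c2: "c2 > 0" using c_pos by (simp add: c2_def)
  have sub: "ball p 1 \<subseteq> exp_region"
  proof
    fix v assume v: "v \<in> ball p 1"
    have "exp (v $ i) \<le> 1 / real CARD('n)" for i
    proof -
      have "\<bar>(v - p) $ i\<bar> \<le> norm (v - p)" by (rule component_le_norm_cart)
      then have "v $ i \<le> p $ i + 1" using v by (auto simp: dist_norm norm_minus_commute)
      also have "\<dots> = ln (1 / real CARD('n))" by (simp add: p_def ln_div)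
      finally show ?thesis by (metis exp_le_cancel_iff exp_ln of_nat_0_less_iff zero_less_card_finite zero_less_divide_1_iff)
    qed
    then have "(\<Sum>i\<in>UNIV. exp (v $ i)) \<le> (\<Sum>i\<in>(UNIV::'n set). 1 / real CARD('n))"
      by (intro sum_mono) auto
    then show "v \<in> exp_region" by (simp add: exp_region_def)
  qed
  have "(\<integral>v. W 1 \<theta> v \<partial>lborel) \<ge> c2 * measure lborel (ball p 1)" if \<theta>: "norm \<theta> \<le> R" for \<theta>
  proof -
    have "c2 * indicator (ball p 1) v \<le> W 1 \<theta> v" for v
    proof (cases "v \<in> ball p 1")
      case True
      have nv: "norm v \<le> r"
        using True norm_triangle_ineq[of p "v - p"] by (auto simp: r_def dist_norm norm_minus_commute)
      then have nd: "norm (v - \<theta>) \<le> r + \<bar>R\<bar>"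
        using \<theta> norm_triangle_ineq4[of v \<theta>] by linarith
      have "- (norm b * r) \<le> b \<bullet> v"
        using Cauchy_Schwarz_ineq2[of b v] mult_left_mono[OF nv, of "norm b"] by simp
      moreover have "(v - \<theta>) \<bullet> (B *v (v - \<theta>)) \<le> K * (r + \<bar>R\<bar>) * (r + \<bar>R\<bar>)"
      proof -
        have "(v - \<theta>) \<bullet> (B *v (v - \<theta>)) \<le> K * norm (v - \<theta>) * norm (v - \<theta>)"
          using bilinear_le[of "v - \<theta>" "v - \<theta>"] by linarith
        also have "\<dots> \<le> K * (r + \<bar>R\<bar>) * (r + \<bar>R\<bar>)"
          using nd K_nonneg norm_ge_zero[of "v - \<theta>"] by (intro mult_mono mult_nonneg_nonneg) linarith+
        finally show ?thesis .
      qed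
      ultimately have "c2 \<le> exp (b \<bullet> v) * dens (v - \<theta>)"
        unfolding c2_def dens_def using c_pos by (intro mult_mono) auto
      then show ?thesis using True sub by (auto simp: W_def)
    qed (simp add: W_nonneg)
    then have "(\<integral>v. c2 * indicator (ball p 1) v \<partial>lborel) \<le> (\<integral>v. W 1 \<theta> v \<partial>lborel)"
      by (intro integral_mono W_integrable) (auto intro!: integrable_mult_right integrable_real_indicator emeasure_lborel_ball_finite[unfolded infinity_ennreal_def])
    then show ?thesis by simp
  qed
  moreover have "c2 * measure lborel (ball p 1) > 0"
    using c2 content_ball_pos[of 1 p] by simp
  ultimately show ?thesis by blast
qed

lemma mean_bounded:
  "\<exists>a>0. \<forall>l\<ge>1. \<forall>\<theta>. norm \<theta> \<le> R \<longrightarrow> (\<integral>v. norm v * W l \<theta> v \<partial>lborel) \<le> a * (\<integral>v. W l \<theta> v \<partial>lborel)"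
proof -
  obtain c1 where c1: "c1 > 0" "\<And>\<theta>. norm \<theta> \<le> R \<Longrightarrow> (\<integral>v. W 1 \<theta> v \<partial>lborel) \<ge> c1"
    using W_integral_bounded_below[of R] by blast
  define a where "a = 1 / c1"
  have a: "a > 0" using c1 by (simp add: a_def)
  have "(\<integral>v. norm v * W l \<theta> v \<partial>lborel) \<le> (a / bmin) * (\<integral>v. W l \<theta> v \<partial>lborel)"
    if l: "l \<ge> 1" and \<theta>: "norm \<theta> \<le> R" for l \<theta>
  proof -
    let ?X = "\<lambda>v. - (b \<bullet> v)"
    have int: "integrable lborel (\<lambda>v. ?X v * W k \<theta> v - a * W k \<theta> v)" if "k \<ge> 1" for k
      using that by (intro Bochner_Integration.integrable_diff weighted_W_integrable integrable_mult_right W_integrable) auto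
    have intg: "(\<integral>v. ?X v * W k \<theta> v - a * W k \<theta> v \<partial>lborel)
        = (\<integral>v. ?X v * W k \<theta> v \<partial>lborel) - a * (\<integral>v. W k \<theta> v \<partial>lborel)" if "k \<ge> 1" for k
      using that by (subst Bochner_Integration.integral_diff[OF weighted_W_integrable integrable_mult_right[OF W_integrable]]) auto
    have "(\<integral>v. ?X v * W 1 \<theta> v \<partial>lborel) \<le> (\<integral>v. dens (v - \<theta>) \<partial>lborel)"
      by (intro integral_mono weighted_W_integrable integrable_lborel_translation dens_integrable weighted_W_le_dens) auto
    also have "\<dots> = a * c1"
      using integral_lborel_translation[OF dens_integrable] dens_integral c1 by (simp add: a_def)
    also have "\<dots> \<le> a * (\<integral>v. W 1 \<theta> v \<partial>lborel)"
      using c1(2)[OF \<theta>] a by simp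
    finally have base: "(\<integral>v. ?X v * W 1 \<theta> v - a * W 1 \<theta> v \<partial>lborel) \<le> 0"
      unfolding intg[OF order_refl] by linarith
    \<comment> \<open>\<open>x \<mapsto> exp (- (l - 1) * x)\<close> is decreasing, so more tilt can only lower the mean of \<open>?X\<close>.\<close>
    have "?X v * W l \<theta> v - a * W l \<theta> v \<le> exp (- (l - 1) * a) * (?X v * W 1 \<theta> v - a * W 1 \<theta> v)" for v
    proof -
      have "W l \<theta> v = exp (- (l - 1) * ?X v) * W 1 \<theta> v"
        by (simp add: W_def algebra_simps flip: exp_add)
      moreover have "(?X v - a) * exp (- (l - 1) * ?X v) \<le> (?X v - a) * exp (- (l - 1) * a)"
      proof (cases "?X v \<ge> a")
        case True
        then show ?thesis using l mult_left_mono[of a "?X v" "l - 1"]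
            by (intro mult_left_mono) (auto simp: algebra_simps)
      next
        case False
        then show ?thesis using l mult_left_mono[of "?X v" a "l - 1"]
            by (intro mult_left_mono_neg) (auto simp: algebra_simps)
      qed
      from mult_right_mono[OF this W_nonneg[of 1 \<theta> v]] calculation show ?thesis
        by (simp add: algebra_simps)
    qed
    then have "(\<integral>v. ?X v * W l \<theta> v - a * W l \<theta> v \<partial>lborel)
        \<le> (\<integral>v. exp (- (l - 1) * a) * (?X v * W 1 \<theta> v - a * W 1 \<theta> v) \<partial>lborel)"
      using l by (intro integral_mono int integrable_mult_right) auto
    also have "\<dots> = exp (- (l - 1) * a) * (\<integral>v. ?X v * W 1 \<theta> v - a * W 1 \<theta> v \<partial>lborel)"
      by (rule integral_mult_right_zero)
    also have "\<dots> \<le> 0" using base by (intro mult_nonneg_nonpos) auto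
    finally have main: "(\<integral>v. ?X v * W l \<theta> v \<partial>lborel) \<le> a * (\<integral>v. W l \<theta> v \<partial>lborel)"
      unfolding intg[OF l] by linarith
    have "(\<integral>v. norm v * W l \<theta> v \<partial>lborel) \<le> (\<integral>v. (1 / bmin) * (?X v * W l \<theta> v) \<partial>lborel)"
      using l by (intro integral_mono norm_W_integrable norm_W_le integrable_mult_right weighted_W_integrable) auto
    also have "\<dots> = (1 / bmin) * (\<integral>v. ?X v * W l \<theta> v \<partial>lborel)"
      by (rule integral_mult_right_zero)
    also have "\<dots> \<le> (1 / bmin) * (a * (\<integral>v. W l \<theta> v \<partial>lborel))"
      using main bmin_pos by (intro mult_left_mono) auto
    finally show ?thesis by simp
  qed
  then show ?thesis using a bmin_pos by (intro exI[of _ "a / bmin"]) auto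
qed

text \<open>The same value of \<open>H\<close> is written once with tilt \<open>l\<close> and once,
  after moving \<open>(l - 1) *\<^sub>R 1\<close> into the centre, with tilt 1. The prefactor in
  \<open>H_eq\<close> is positive, so positivity carries over.\<close>

lemma W_integral_pos: "l \<ge> 1 \<Longrightarrow> (\<integral>v. W l \<theta> v \<partial>lborel) > 0"
proof -
  assume l: "l \<ge> 1"
  define \<theta>' where "\<theta>' = \<theta> + (l - 1) *\<^sub>R 1"
  obtain c1 where "c1 > 0" "(\<integral>v. W 1 \<theta>' v \<partial>lborel) \<ge> c1"
    using W_integral_bounded_below[of "norm \<theta>'"] by auto
  then have "H (\<theta>' + 1 *\<^sub>R 1) > 0" unfolding H_eq by simp
  also have "\<theta>' + 1 *\<^sub>R 1 = \<theta> + l *\<^sub>R 1" by (simp add: \<theta>'_def algebra_simps)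
  finally show ?thesis unfolding H_eq by (simp add: zero_less_mult_iff)
qed

lemma H_pos: "H x > 0"
  using W_integral_pos[of 1 "x - 1"] H_eq[of "x - 1" 1] by simp

section \<open>First and second differences of \<open>H\<close>, uniformly in the tilt\<close>

text \<open>The decaying exponential of \<open>norm v\<close> in \<open>W_pointwise_ge\<close> is
  replaced by its tangent at the mean bound \<open>a\<close>. Since the mean is at most
  \<open>a\<close>, the linear term integrates to something nonnegative, and at least the value of
  the exponential at \<open>a\<close> survives.\<close>

lemma H_ratio_bound:
  "\<exists>C>0. \<forall>l\<ge>1. \<forall>\<theta> \<theta>'. norm \<theta> \<le> R \<longrightarrow> norm \<theta>' \<le> R \<longrightarrow>
     H (\<theta> + l *\<^sub>R 1) \<ge> exp (- l * (b \<bullet> (\<theta> - \<theta>')) - C * norm (\<theta> - \<theta>')) * H (\<theta>' + l *\<^sub>R 1)"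
proof -
  obtain a where a: "a > 0" "\<And>l \<theta>. l \<ge> 1 \<Longrightarrow> norm \<theta> \<le> R \<Longrightarrow>
      (\<integral>v. norm v * W l \<theta> v \<partial>lborel) \<le> a * (\<integral>v. W l \<theta> v \<partial>lborel)"
    using mean_bounded[of R] by blast
  \<comment> \<open>The summands pay for the tangent point, for the constant term of
    \<open>W_pointwise_ge\<close>, and for strict positivity.\<close>
  define C where "C = K * a + 2 * \<bar>R\<bar> * K + 1"
  have C: "C > 0" using K_nonneg a by (simp add: C_def add_nonneg_pos)
  have "H (\<theta> + l *\<^sub>R 1) \<ge> exp (- l * (b \<bullet> (\<theta> - \<theta>')) - C * norm (\<theta> - \<theta>')) * H (\<theta>' + l *\<^sub>R 1)"
    if l: "l \<ge> 1" and \<theta>: "norm \<theta> \<le> R" and \<theta>': "norm \<theta>' \<le> R" for l \<theta> \<theta>'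
  proof -
    let ?s = "K * norm (\<theta> - \<theta>')" and ?I = "\<integral>v. W l \<theta>' v \<partial>lborel"
    define e where "e = exp (- (?s * a) - 2 * R * K * norm (\<theta> - \<theta>'))"
    have s: "?s \<ge> 0" using K_nonneg by simp
    have i1: "integrable lborel (\<lambda>v. (1 + ?s * a) * W l \<theta>' v)" "integrable lborel (\<lambda>v. ?s * (norm v * W l \<theta>' v))"
      using l by (intro integrable_mult_right W_integrable norm_W_integrable; simp)+
    have "e * ((1 + ?s * a) * W l \<theta>' v - ?s * (norm v * W l \<theta>' v)) \<le> W l \<theta> v" for v
    proof -
      have "e * (1 + (?s * a - ?s * norm v)) \<le> e * exp (?s * a - ?s * norm v)"
        by (intro mult_left_mono exp_ge_add_one_self) (simp add: e_def)
      also have "\<dots> = exp (- ?s * norm v - 2 * R * K * norm (\<theta> - \<theta>'))"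
        by (simp add: e_def flip: exp_add)
      finally have "e * (1 + (?s * a - ?s * norm v)) * W l \<theta>' v
          \<le> exp (- ?s * norm v - 2 * R * K * norm (\<theta> - \<theta>')) * W l \<theta>' v"
        by (rule mult_right_mono) (rule W_nonneg)
      also have "\<dots> \<le> W l \<theta> v" by (rule W_pointwise_ge[OF \<theta> \<theta>'])
      finally show ?thesis by (simp add: algebra_simps)
    qed
    then have "(\<integral>v. e * ((1 + ?s * a) * W l \<theta>' v - ?s * (norm v * W l \<theta>' v)) \<partial>lborel) \<le> (\<integral>v. W l \<theta> v \<partial>lborel)"
      using l by (intro integral_mono integrable_mult_right Bochner_Integration.integrable_diff i1 W_integrable) auto
    also have "(\<integral>v. e * ((1 + ?s * a) * W l \<theta>' v - ?s * (norm v * W l \<theta>' v)) \<partial>lborel)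
        = e * ((1 + ?s * a) * ?I - ?s * (\<integral>v. norm v * W l \<theta>' v \<partial>lborel))"
      by (simp only: integral_mult_right_zero Bochner_Integration.integral_diff[OF i1])
    finally have 1: "e * ((1 + ?s * a) * ?I - ?s * (\<integral>v. norm v * W l \<theta>' v \<partial>lborel)) \<le> (\<integral>v. W l \<theta> v \<partial>lborel)" .
    have "?I \<le> (1 + ?s * a) * ?I - ?s * (\<integral>v. norm v * W l \<theta>' v \<partial>lborel)"
      using mult_left_mono[OF a(2)[OF l \<theta>'] s] by (simp add: algebra_simps)
    then have 2: "e * ?I \<le> (\<integral>v. W l \<theta> v \<partial>lborel)"
      using 1 by (elim order_trans[OF mult_left_mono]) (simp add: e_def)
    have "exp (- C * norm (\<theta> - \<theta>')) \<le> e"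
    proof -
      have "?s * a + 2 * R * K * norm (\<theta> - \<theta>') = (K * a + 2 * R * K) * norm (\<theta> - \<theta>')"
        by (simp add: algebra_simps)
      also have "\<dots> \<le> C * norm (\<theta> - \<theta>')"
        unfolding C_def using K_nonneg mult_right_mono[OF abs_ge_self[of R] K_nonneg]
        by (intro mult_right_mono) auto
      finally show ?thesis unfolding e_def by simp
    qed
    then have 3: "exp (- C * norm (\<theta> - \<theta>')) * ?I \<le> (\<integral>v. W l \<theta> v \<partial>lborel)"
      using mult_right_mono[of _ e ?I] W_integral_pos[OF l, of \<theta>'] by (intro order_trans[OF _ 2]) auto
    have "exp (- l * (b \<bullet> (\<theta> - \<theta>')) - C * norm (\<theta> - \<theta>')) * H (\<theta>' + l *\<^sub>R 1)
        = exp (- l * (b \<bullet> \<theta>) - l\<^sup>2 * tot / 2) * (exp (- C * norm (\<theta> - \<theta>')) * ?I)"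
      unfolding H_eq by (simp add: inner_diff_right algebra_simps flip: exp_add mult.assoc)
    also have "\<dots> \<le> H (\<theta> + l *\<^sub>R 1)"
      unfolding H_eq using 3 by (intro mult_left_mono) auto
    finally show ?thesis .
  qed
  then show ?thesis using C by blast
qed

text \<open>The tangent of \<open>exp\<close> at the middle point bounds the second difference of the integrand from
  below by a function affine in \<open>norm v\<close>; only the linear term \<open>l * (b \<bullet> D)\<close> grows with \<open>l\<close>.\<close>

lemma H_second_difference:
  "\<exists>l0\<ge>1. \<forall>l\<ge>l0. \<forall>\<theta> \<delta> \<delta>'. norm \<theta> \<le> R \<longrightarrow> (\<forall>i. (\<delta> + \<delta>') $ i \<ge> 0) \<longrightarrow> \<delta> + \<delta>' \<noteq> 0 \<longrightarrow>
     (norm \<delta>)\<^sup>2 + (norm \<delta>')\<^sup>2 \<le> M * (\<Sum>i\<in>UNIV. (\<delta> + \<delta>') $ i) \<longrightarrow>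
     H (\<theta> - \<delta> + l *\<^sub>R 1) + H (\<theta> - \<delta>' + l *\<^sub>R 1) > 2 * H (\<theta> + l *\<^sub>R 1)"
proof -
  obtain a where a: "a > 0" "\<And>l \<theta>. l \<ge> 1 \<Longrightarrow> norm \<theta> \<le> R \<Longrightarrow>
      (\<integral>v. norm v * W l \<theta> v \<partial>lborel) \<le> a * (\<integral>v. W l \<theta> v \<partial>lborel)"
    using mean_bounded[of R] by blast
  \<comment> \<open>Chosen to give \<open>k - K * s * a > 0\<close> at the end: the gain
    \<open>l * bmin * s\<close> must exceed the cost \<open>K * s * (a + R)\<close> of the linear
    terms and \<open>K * M * s / 2\<close> of the quadratic ones. All three are proportional to
    \<open>s\<close>, so the threshold does not depend on the displacements.\<close>
  define l0 where "l0 = max 1 ((K * (a + R) + K * M / 2) / bmin + 1)"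
  have "H (\<theta> - \<delta> + l *\<^sub>R 1) + H (\<theta> - \<delta>' + l *\<^sub>R 1) > 2 * H (\<theta> + l *\<^sub>R 1)"
    if l: "l \<ge> l0" and \<theta>: "norm \<theta> \<le> R" and D0: "\<And>i. (\<delta> + \<delta>') $ i \<ge> 0" and D1: "\<delta> + \<delta>' \<noteq> 0"
      and D2: "(norm \<delta>)\<^sup>2 + (norm \<delta>')\<^sup>2 \<le> M * (\<Sum>i\<in>UNIV. (\<delta> + \<delta>') $ i)" for l \<theta> \<delta> \<delta>'
  proof -
    define D where "D = \<delta> + \<delta>'"
    \<comment> \<open>As the coordinates of \<open>D\<close> are nonnegative, \<open>s\<close> is
      its l1 norm: an upper bound for \<open>norm D\<close> and, times \<open>bmin\<close>, a lower
      bound for \<open>b \<bullet> D\<close>.\<close>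
    define s where "s = (\<Sum>i\<in>UNIV. D $ i)"
    define g where "g = exp (- l * (b \<bullet> \<theta>) - l\<^sup>2 * tot / 2)"
    define w where "w v = g * W l \<theta> v" for v
    define k where "k = l * bmin * s - K * s * R - K * M * s / 2"
    have l1: "l \<ge> 1" using l by (simp add: l0_def)
    have nD: "norm D \<le> s"
      using norm_le_l1_cart[of D] D0 by (simp add: s_def D_def)
    then have s: "s > 0" using D1 by (simp add: D_def) (metis less_le_trans zero_less_norm_iff)
    have bD: "bmin * s \<le> b \<bullet> D"
      unfolding s_def sum_distrib_left inner_vec_def using D0 bmin_le
      by (auto intro!: sum_mono mult_right_mono simp: D_def)
    have w: "w v = indicator exp_region v * dens (v - (\<theta> + l *\<^sub>R 1))" for v
      unfolding integrand_eq w_def g_def by simp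
    have iw: "integrable lborel w" "integrable lborel (\<lambda>v. norm v * w v)"
      using l1 W_integrable[of l \<theta>] norm_W_integrable[OF l1, of \<theta>]
      by (simp_all add: w_def[abs_def] mult.left_commute)
    have w0: "w v \<ge> 0" for v using W_nonneg by (simp add: w_def g_def)
    have iH: "integrable lborel (\<lambda>v. indicator exp_region v * dens (v - x))" for x
      by (rule Bochner_Integration.integrable_bound[OF integrable_lborel_translation[OF dens_integrable, of x]])
        (use dens_pos in \<open>auto simp: indicator_def\<close>)
    have Hw: "H (\<theta> + l *\<^sub>R 1) = (\<integral>v. w v \<partial>lborel)" unfolding H_def w ..
    have mean: "(\<integral>v. norm v * w v \<partial>lborel) \<le> a * (\<integral>v. w v \<partial>lborel)"
    proof -
      have "g * (\<integral>v. norm v * W l \<theta> v \<partial>lborel) \<le> g * (a * (\<integral>v. W l \<theta> v \<partial>lborel))"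
        using a(2)[OF l1 \<theta>] by (intro mult_left_mono) (auto simp: g_def)
      then show ?thesis by (simp add: w_def mult.left_commute)
    qed
    have pt: "(2 + k) * w v - K * s * (norm v * w v)
        \<le> indicator exp_region v * dens (v - (\<theta> - \<delta> + l *\<^sub>R 1)) + indicator exp_region v * dens (v - (\<theta> - \<delta>' + l *\<^sub>R 1))" for v
    proof (cases "v \<in> exp_region")
      case True
      let ?x = "v - (\<theta> + l *\<^sub>R 1)"
      let ?E = "\<lambda>d. - (d \<bullet> (B *v ?x)) - (d \<bullet> (B *v d)) / 2"
      have "D \<bullet> (B *v ?x) = D \<bullet> (B *v (v - \<theta>)) - l * (b \<bullet> D)"
      proof -
        have "B *v ?x = B *v (v - \<theta>) - l *\<^sub>R b"
          by (simp add: matrix_vector_mult_diff_distrib matrix_vector_right_distrib matrix_vector_mult_scaleR b_eq)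
        then show ?thesis by (simp only: inner_diff_right inner_scaleR_right inner_commute[of D b])
      qed
      moreover have "D \<bullet> (B *v (v - \<theta>)) \<le> K * s * (norm v + R)"
      proof -
        have "D \<bullet> (B *v (v - \<theta>)) \<le> K * norm D * norm (v - \<theta>)"
          using bilinear_le[of D "v - \<theta>"] by linarith
        also have "\<dots> \<le> K * s * (norm v + R)"
          using nD K_nonneg norm_triangle_ineq4[of v \<theta>] \<theta> s by (intro mult_mono mult_nonneg_nonneg) auto
        finally show ?thesis .
      qed
      moreover have "l * (bmin * s) \<le> l * (b \<bullet> D)" using bD l1 by (intro mult_left_mono) auto
      moreover have "\<delta> \<bullet> (B *v \<delta>) + \<delta>' \<bullet> (B *v \<delta>') \<le> K * (M * s)"
      proof -
        have "\<delta> \<bullet> (B *v \<delta>) + \<delta>' \<bullet> (B *v \<delta>') \<le> K * ((norm \<delta>)\<^sup>2 + (norm \<delta>')\<^sup>2)"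
          using bilinear_le[of \<delta> \<delta>] bilinear_le[of \<delta>' \<delta>'] by (simp add: power2_eq_square algebra_simps)
        also have "\<dots> \<le> K * (M * s)" using D2 K_nonneg by (intro mult_left_mono) (auto simp: s_def D_def)
        finally show ?thesis .
      qed
      moreover have "\<delta> \<bullet> (B *v ?x) + \<delta>' \<bullet> (B *v ?x) = D \<bullet> (B *v ?x)"
        by (simp add: D_def inner_add_left)
      moreover have "K * s * (norm v + R) = K * s * norm v + K * s * R"
        "l * (bmin * s) = l * bmin * s" "K * (M * s) = K * M * s"
        by (simp_all add: distrib_left)
      ultimately have "2 + k - K * s * norm v \<le> (1 + ?E \<delta>) + (1 + ?E \<delta>')"
        unfolding k_def by linarith
      also have "\<dots> \<le> exp (?E \<delta>) + exp (?E \<delta>')"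
        by (intro add_mono exp_ge_add_one_self)
      finally have "(2 + k - K * s * norm v) * dens ?x \<le> (exp (?E \<delta>) + exp (?E \<delta>')) * dens ?x"
        using dens_pos[of ?x] by (intro mult_right_mono) auto
      also have "\<dots> = dens (?x + \<delta>) + dens (?x + \<delta>')"
        unfolding dens_shift by (simp add: algebra_simps)
      finally show ?thesis using True by (simp add: w algebra_simps)
    qed (simp add: w)
    have i1: "integrable lborel (\<lambda>v. (2 + k) * w v)" "integrable lborel (\<lambda>v. K * s * (norm v * w v))"
      by (intro integrable_mult_right iw)+
    have "(2 + k) * (\<integral>v. w v \<partial>lborel) - K * s * (\<integral>v. norm v * w v \<partial>lborel)
        = (\<integral>v. (2 + k) * w v - K * s * (norm v * w v) \<partial>lborel)"
      by (simp only: integral_mult_right_zero Bochner_Integration.integral_diff[OF i1])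
    also have "\<dots> \<le> (\<integral>v. indicator exp_region v * dens (v - (\<theta> - \<delta> + l *\<^sub>R 1))
        + indicator exp_region v * dens (v - (\<theta> - \<delta>' + l *\<^sub>R 1)) \<partial>lborel)"
      by (intro integral_mono Bochner_Integration.integrable_diff Bochner_Integration.integrable_add i1 iH pt)
    also have "\<dots> = H (\<theta> - \<delta> + l *\<^sub>R 1) + H (\<theta> - \<delta>' + l *\<^sub>R 1)"
      unfolding H_def by (rule Bochner_Integration.integral_add[OF iH iH])
    finally have 1: "(2 + k) * H (\<theta> + l *\<^sub>R 1) - K * s * (\<integral>v. norm v * w v \<partial>lborel)
        \<le> H (\<theta> - \<delta> + l *\<^sub>R 1) + H (\<theta> - \<delta>' + l *\<^sub>R 1)" unfolding Hw .
    have 2: "K * s * (\<integral>v. norm v * w v \<partial>lborel) \<le> K * s * (a * H (\<theta> + l *\<^sub>R 1))"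
      using mean K_nonneg s unfolding Hw by (intro mult_left_mono) auto
    have "(K * (a + R) + K * M / 2) / bmin < l" using l by (auto simp: l0_def)
    then have "K * (a + R) + K * M / 2 < l * bmin" using bmin_pos by (simp add: field_simps)
    from mult_strict_right_mono[OF this s] have "k - K * s * a > 0" by (simp add: k_def algebra_simps)
    from mult_pos_pos[OF this H_pos[of "\<theta> + l *\<^sub>R 1"]] 1 2 show ?thesis by (simp add: algebra_simps)
  qed
  then show ?thesis by (intro exI[of _ l0]) (auto simp: l0_def)
qed

end

section \<open>Logarithm estimates away from zero\<close>

text \<open>Strong concavity of \<open>ln\<close> on (0, 1]. For the midpoint \<open>m\<close> the
  right side is \<open>- ln (x * y / m\<^sup>2)\<close>, where
  \<open>x * y / m\<^sup>2 = 1 - (x - y)\<^sup>2 / (4 * m\<^sup>2)\<close>; then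
  \<open>ln t \<le> t - 1\<close> and \<open>m \<le> 1\<close> finish.\<close>

lemma ln_second_difference:
  fixes x y :: real
  assumes "0 < x" "x \<le> 1" "0 < y" "y \<le> 1"
  shows "(x - y)\<^sup>2 / 4 \<le> (ln ((x + y) / 2) - ln x) + (ln ((x + y) / 2) - ln y)"
proof -
  define m where "m = (x + y) / 2"
  have m: "0 < m" "m \<le> 1" using assms by (auto simp: m_def)
  have "ln (x * y / m\<^sup>2) \<le> x * y / m\<^sup>2 - 1"
    using assms m by (intro ln_le_minus_one) auto
  also have "\<dots> = - ((x - y)\<^sup>2 / 4) / m\<^sup>2"
  proof -
    have "x * y = m\<^sup>2 - (x - y)\<^sup>2 / 4" by (simp add: m_def power2_eq_square field_simps)
    then show ?thesis using m by (simp add: diff_divide_distrib)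
  qed
  also have "\<dots> \<le> - ((x - y)\<^sup>2 / 4)"
  proof -
    have "m\<^sup>2 \<le> 1" using m by (simp add: power_le_one)
    then have "(x - y)\<^sup>2 / 4 * m\<^sup>2 \<le> (x - y)\<^sup>2 / 4 * 1" by (intro mult_left_mono) auto
    then have "(x - y)\<^sup>2 / 4 \<le> (x - y)\<^sup>2 / 4 / m\<^sup>2" using m by (simp add: pos_le_divide_eq)
    then show ?thesis by simp
  qed
  also have "ln (x * y / m\<^sup>2) = ln x + ln y - 2 * ln m"
    using assms m by (simp add: ln_div ln_mult ln_realpow)
  finally show ?thesis unfolding m_def[symmetric] by linarith
qed

lemma abs_ln_diff_le:
  fixes x y :: real
  assumes "0 < e" "e \<le> x" "e \<le> y"
  shows "\<bar>ln x - ln y\<bar> \<le> \<bar>x - y\<bar> / e"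
proof -
  have *: "ln x - ln y \<le> \<bar>x - y\<bar> / e" if "e \<le> x" "e \<le> y" for x y :: real
  proof -
    have "ln x - ln y \<le> (x - y) / y" using that assms by (intro ln_diff_le) auto
    also have "\<dots> \<le> \<bar>x - y\<bar> / y" using that assms by (intro divide_right_mono) auto
    also have "\<dots> \<le> \<bar>x - y\<bar> / e" using that assms by (intro divide_left_mono) auto
    finally show ?thesis .
  qed
  show ?thesis using *[of x y] *[of y x] assms by (auto simp: abs_minus_commute)
qed

text \<open>The lower bound keeps logarithms bounded. The upper bound makes \<open>1\<close> a
  dominating portfolio, so that \<open>\<alpha> \<le> F 1 y\<close> expresses smallness of
  \<open>\<alpha>\<close> uniformly in \<open>u\<close> (\<open>F_one_le\<close>).\<close>

definition positive_cube :: "real \<Rightarrow> (real ^ 'n) set" where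
  "positive_cube \<epsilon> = {u. \<forall>i. \<epsilon> \<le> u $ i \<and> u $ i \<le> 1}"

lemma norm_ln_vec_le:
  assumes "u \<in> positive_cube \<epsilon>" "\<epsilon> > 0"
  shows "norm (ln_vec u :: real ^ 'n) \<le> real CARD('n) * \<bar>ln \<epsilon>\<bar>"
proof -
  have "norm (ln_vec u) \<le> (\<Sum>i\<in>UNIV. \<bar>ln_vec u $ i\<bar>)" by (rule norm_le_l1_cart)
  also have "\<dots> \<le> (\<Sum>i\<in>(UNIV::'n set). \<bar>ln \<epsilon>\<bar>)"
  proof (rule sum_mono)
    fix i
    have "\<epsilon> \<le> u $ i" "u $ i \<le> 1" using assms by (auto simp: positive_cube_def)
    then have "ln \<epsilon> \<le> ln (u $ i)" "ln (u $ i) \<le> 0" using assms by auto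
    then show "\<bar>ln_vec u $ i\<bar> \<le> \<bar>ln \<epsilon>\<bar>" by simp
  qed
  finally show ?thesis by simp
qed

section \<open>Distribution function and quantile of the portfolio\<close>

locale lognormal_portfolio = gaussian_density B b c + prob_space M
  for B :: "real ^ 'n ^ 'n" and b c and M :: "'a measure" +
  fixes Z X :: "'a \<Rightarrow> real ^ 'n" and \<mu> :: "real ^ 'n"
  assumes Z_density: "distributed M lborel Z (\<lambda>z. ennreal (dens (z - \<mu>)))"
    and X_eq: "\<omega> \<in> space M \<Longrightarrow> X \<omega> $ i = exp (Z \<omega> $ i)"
begin

definition F :: "real ^ 'n \<Rightarrow> real \<Rightarrow> real" where
  "F u y = measure M {\<omega> \<in> space M. (\<Sum>i\<in>UNIV. u $ i * X \<omega> $ i) \<le> y}"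

abbreviation q :: "real \<Rightarrow> real ^ 'n \<Rightarrow> real" where
  "q \<equiv> portfolio_quantile M X"

lemma q_eq: "q \<alpha> u = Inf {y. F u y \<ge> \<alpha>}"
  by (simp add: portfolio_quantile_def F_def)

lemma Z_measurable: "Z \<in> measurable M borel"
  using distributed_measurable[OF Z_density] by simp

lemma sum_measurable: "(\<lambda>\<omega>. \<Sum>i\<in>UNIV. u $ i * X \<omega> $ i) \<in> borel_measurable M"
proof -
  have [measurable]: "(\<lambda>\<omega>. Z \<omega> $ i) \<in> borel_measurable M" for i
    by (rule measurable_compose[OF Z_measurable]) (intro borel_measurable_continuous_onI continuous_intros)
  have "(\<lambda>\<omega>. \<Sum>i\<in>UNIV. u $ i * exp (Z \<omega> $ i)) \<in> borel_measurable M" by measurable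
  then show ?thesis by (subst measurable_cong[where g = "\<lambda>\<omega>. \<Sum>i\<in>UNIV. u $ i * exp (Z \<omega> $ i)"]) (simp_all add: X_eq)
qed

lemma F_sets: "{\<omega> \<in> space M. (\<Sum>i\<in>UNIV. u $ i * X \<omega> $ i) \<le> y} \<in> events"
  using sum_measurable[of u] by measurable

text \<open>Since \<open>u $ i * X \<omega> $ i / y = exp (Z \<omega> $ i + ln (u $ i) - ln
  y)\<close>, the event says that a translate of \<open>Z\<close> lies in \<open>exp_region\<close>.
  The rest is translation invariance of Lebesgue measure.\<close>

lemma F_eq_H:
  assumes u: "\<And>i. u $ i > 0" and y: "y > 0"
  shows "F u y = H (ln_vec u + \<mu> + (- ln y) *\<^sub>R 1)"
proof -
  define a where "a = ln_vec u + (- ln y) *\<^sub>R 1"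
  define h where "h z = indicator exp_region (z + a) * dens (z - \<mu>)" for z
  have meas: "(\<lambda>z. z + a) -` exp_region \<in> sets borel"
    using measurable_sets[of "\<lambda>z. z + a" borel borel exp_region] by simp
  have h0: "h z \<ge> 0" for z using dens_pos[of "z - \<mu>"] by (simp add: h_def)
  have h_meas: "h \<in> borel_measurable borel" unfolding h_def[abs_def] by measurable
  have h: "integrable lborel h"
    by (rule Bochner_Integration.integrable_bound[OF integrable_lborel_translation[OF dens_integrable, of \<mu>]])
      (use dens_pos h_meas in \<open>auto simp: h_def indicator_def\<close>)
  have "{\<omega> \<in> space M. (\<Sum>i\<in>UNIV. u $ i * X \<omega> $ i) \<le> y} = Z -` ((\<lambda>z. z + a) -` exp_region) \<inter> space M"
  proof -
    have "(\<Sum>i\<in>UNIV. exp ((Z \<omega> + a) $ i)) = (\<Sum>i\<in>UNIV. u $ i * X \<omega> $ i) / y" if "\<omega> \<in> space M" for \<omega>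
      using u y that by (simp add: a_def X_eq exp_add exp_diff sum_divide_distrib mult.commute)
    then show ?thesis using y by (auto simp: exp_region_def)
  qed
  then have "ennreal (F u y) = emeasure M (Z -` ((\<lambda>z. z + a) -` exp_region) \<inter> space M)"
    by (simp add: F_def emeasure_eq_measure)
  also have "\<dots> = (\<integral>\<^sup>+z. ennreal (dens (z - \<mu>)) * indicator ((\<lambda>z. z + a) -` exp_region) z \<partial>lborel)"
    using distributed_emeasure[OF Z_density] meas by simp
  also have "\<dots> = (\<integral>\<^sup>+z. ennreal (h z) \<partial>lborel)"
    by (intro nn_integral_cong) (auto simp: h_def indicator_def)
  also have "\<dots> = ennreal (\<integral>z. h z \<partial>lborel)"
    using h0 by (intro nn_integral_eq_integral h) auto
  finally have "F u y = (\<integral>z. h z \<partial>lborel)"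
    using h0 by (simp add: F_def)
  also have "\<dots> = (\<integral>z. h (z - a) \<partial>lborel)" by (rule integral_lborel_translation[OF h, symmetric])
  also have "\<dots> = H (a + \<mu>)" unfolding H_def h_def by (simp add: algebra_simps)
  finally show ?thesis by (simp add: a_def algebra_simps)
qed

lemma F_pos:
  assumes "\<And>i. u $ i > 0" "y > 0" shows "F u y > 0"
  using F_eq_H[OF assms] H_pos by simp

lemma F_mono: "y \<le> y' \<Longrightarrow> F u y \<le> F u y'"
  unfolding F_def by (intro finite_measure_mono F_sets) auto

lemma F_nonpos:
  assumes "\<And>i. u $ i > 0" "y \<le> 0" shows "F u y = 0"
proof -
  have "(\<Sum>i\<in>UNIV. u $ i * X \<omega> $ i) > 0" if "\<omega> \<in> space M" for \<omega>
    using assms that by (intro sum_pos) (auto simp: X_eq)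
  then have "{\<omega> \<in> space M. (\<Sum>i\<in>UNIV. u $ i * X \<omega> $ i) \<le> y} = {}"
    using assms(2) by fastforce
  then show ?thesis unfolding F_def by (metis measure_empty)
qed

text \<open>As \<open>X\<close> is positive, a coordinatewise bound between portfolios holds
  pathwise for the sums. It serves the uniform threshold \<open>F_one_le\<close> and, through
  \<open>q_scale\<close>, the continuity of the quantile.\<close>

lemma F_scale:
  assumes "\<And>i. u $ i \<le> k * u' $ i" "k > 0" shows "F u' y \<le> F u (k * y)"
  unfolding F_def
proof (intro finite_measure_mono F_sets subsetI)
  fix \<omega> assume \<omega>: "\<omega> \<in> {\<omega> \<in> space M. (\<Sum>i\<in>UNIV. u' $ i * X \<omega> $ i) \<le> y}"
  have "(\<Sum>i\<in>UNIV. u $ i * X \<omega> $ i) \<le> (\<Sum>i\<in>UNIV. k * u' $ i * X \<omega> $ i)"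
    using \<omega> assms by (intro sum_mono mult_right_mono) (auto simp: X_eq)
  also have "\<dots> = k * (\<Sum>i\<in>UNIV. u' $ i * X \<omega> $ i)" by (simp add: sum_distrib_left mult.assoc)
  also have "\<dots> \<le> k * y" using \<omega> assms by (intro mult_left_mono) auto
  finally show "\<omega> \<in> {\<omega> \<in> space M. (\<Sum>i\<in>UNIV. u $ i * X \<omega> $ i) \<le> k * y}" using \<omega> by simp
qed

lemma F_right_continuous: "continuous (at_right y) (F u)"
proof -
  interpret D: real_distribution "distr M borel (\<lambda>\<omega>. \<Sum>i\<in>UNIV. u $ i * X \<omega> $ i)"
    by (intro real_distribution_distr sum_measurable)
  have "cdf (distr M borel (\<lambda>\<omega>. \<Sum>i\<in>UNIV. u $ i * X \<omega> $ i)) = F u"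
    by (auto simp: cdf_def F_def measure_distr[OF sum_measurable] intro!: ext arg_cong[where f = "measure M"])
  then show ?thesis using D.cdf_is_right_cont[of y] by simp
qed

context
  fixes u :: "real ^ 'n" and \<alpha> y :: real
  assumes u: "\<And>i. u $ i > 0" and \<alpha>: "0 < \<alpha>" "\<alpha> \<le> F u y"
begin

lemma level_pos: "\<alpha> \<le> F u z \<Longrightarrow> z > 0"
  using F_nonpos[OF u, of z] \<alpha> by force

text \<open>\<open>Inf\<close> is meaningful only for nonempty sets that are bounded below. The
  context provides both: \<open>y\<close> is a member of the level set, and positivity of
  \<open>\<alpha>\<close> keeps the set to the right of 0.\<close>

lemma q_le: "\<alpha> \<le> F u z \<Longrightarrow> q \<alpha> u \<le> z"
  unfolding q_eq by (rule cInf_lower) (auto intro!: bdd_belowI[of _ 0] dest: level_pos)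

lemma F_q_ge: "\<alpha> \<le> F u (q \<alpha> u)"
proof (rule tendsto_lowerbound)
  show "(F u \<longlongrightarrow> F u (q \<alpha> u)) (at_right (q \<alpha> u))"
    using F_right_continuous[of "q \<alpha> u" u] by (simp add: continuous_within)
  have "\<alpha> \<le> F u z" if z: "z > q \<alpha> u" for z
  proof -
    have "{y. F u y \<ge> \<alpha>} \<noteq> {}" using \<alpha> by auto
    then obtain x where "F u x \<ge> \<alpha>" "x < z" using cInf_lessD[of "{y. F u y \<ge> \<alpha>}" z] z by (auto simp: q_eq)
    then show ?thesis using F_mono[of x z u] by simp
  qed
  then show "\<forall>\<^sub>F z in at_right (q \<alpha> u). \<alpha> \<le> F u z"
    by (auto simp: eventually_at_right_field intro: exI[of _ "q \<alpha> u + 1"])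
qed simp

lemma q_pos: "q \<alpha> u > 0"
  by (rule level_pos[OF F_q_ge])

text \<open>Only left continuity at the quantile is missing. \<open>F u\<close> is below
  \<open>\<alpha>\<close> at \<open>q \<alpha> u * exp (- s)\<close>, while
  \<open>H_ratio_bound\<close> keeps it above a multiple of \<open>F u (q \<alpha> u)\<close> that
  tends to 1 as \<open>s\<close> tends to 0. The bound \<open>exp (- 1)\<close> gives
  \<open>l \<ge> 1\<close>.\<close>

lemma F_q_eq:
  assumes q: "q \<alpha> u \<le> exp (- 1)" shows "F u (q \<alpha> u) = \<alpha>"
proof (rule antisym[OF _ F_q_ge])
  define l where "l = - ln (q \<alpha> u)"
  define \<theta> where "\<theta> = ln_vec u + \<mu>"
  have l: "l \<ge> 1" using q q_pos ln_le_cancel_iff[of "q \<alpha> u" "exp (- 1)"] by (simp add: l_def)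
  obtain C where C: "\<And>\<theta>' \<theta>''. norm \<theta>' \<le> norm \<theta> + norm (1 :: real ^ 'n) \<Longrightarrow> norm \<theta>'' \<le> norm \<theta> + norm (1 :: real ^ 'n) \<Longrightarrow>
      H (\<theta>' + l *\<^sub>R 1) \<ge> exp (- l * (b \<bullet> (\<theta>' - \<theta>'')) - C * norm (\<theta>' - \<theta>'')) * H (\<theta>'' + l *\<^sub>R 1)"
    using H_ratio_bound[of "norm \<theta> + norm (1 :: real ^ 'n)"] l by blast
  let ?g = "\<lambda>s. exp (- l * (b \<bullet> (s *\<^sub>R 1)) - C * norm (s *\<^sub>R (1 :: real ^ 'n))) * F u (q \<alpha> u)"
  have F\<theta>: "F u (q \<alpha> u) = H (\<theta> + l *\<^sub>R 1)"
    unfolding \<theta>_def l_def by (rule F_eq_H[OF u q_pos])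
  show "F u (q \<alpha> u) \<le> \<alpha>"
  proof (rule tendsto_upperbound)
    have "(?g \<longlongrightarrow> exp (- l * (b \<bullet> (0 *\<^sub>R 1)) - C * norm (0 *\<^sub>R (1 :: real ^ 'n))) * F u (q \<alpha> u)) (at_right 0)"
      by (intro tendsto_intros)
    then show "(?g \<longlongrightarrow> F u (q \<alpha> u)) (at_right 0)" by simp
    have "?g s \<le> \<alpha>" if s: "0 < s" "s < 1" for s
    proof -
      have "q \<alpha> u * exp (- s) < q \<alpha> u" using q_pos s by simp
      then have "F u (q \<alpha> u * exp (- s)) < \<alpha>" using q_le[of "q \<alpha> u * exp (- s)"] by force
      moreover have "F u (q \<alpha> u * exp (- s)) = H ((\<theta> + s *\<^sub>R 1) + l *\<^sub>R 1)"
        using q_pos by (subst F_eq_H[OF u]) (simp_all add: \<theta>_def l_def ln_mult algebra_simps)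
      moreover have "?g s \<le> H ((\<theta> + s *\<^sub>R 1) + l *\<^sub>R 1)"
      proof -
        have "norm (s *\<^sub>R (1 :: real ^ 'n)) \<le> norm (1 :: real ^ 'n)"
          using s by (simp add: mult_left_le_one_le)
        then have "norm (\<theta> + s *\<^sub>R 1) \<le> norm \<theta> + norm (1 :: real ^ 'n)"
          using norm_triangle_ineq[of \<theta> "s *\<^sub>R 1"] by linarith
        from C[OF this, of \<theta>] show ?thesis unfolding F\<theta> by simp
      qed
      ultimately show ?thesis by simp
    qed
    then show "\<forall>\<^sub>F s in at_right 0. ?g s \<le> \<alpha>"
      by (auto simp: eventually_at_right_field intro: exI[of _ 1])
  qed simp
qed

end

lemma cube_pos: "u \<in> positive_cube \<epsilon> \<Longrightarrow> \<epsilon> > 0 \<Longrightarrow> u $ i > 0"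
  by (auto simp: positive_cube_def intro: less_le_trans)

lemma F_one_pos: "y > 0 \<Longrightarrow> F 1 y > 0"
  by (rule F_pos) auto

lemma F_one_le:
  assumes "u \<in> positive_cube \<epsilon>" shows "F 1 y \<le> F u y"
  using F_scale[of u 1 1 y] assms by (auto simp: positive_cube_def)

section \<open>Logarithmic comparison of quantiles and strict midpoint convexity\<close>

text \<open>The level \<open>q \<alpha> u'\<close> is enlarged by the factor \<open>exp s\<close>.
  The excess \<open>\<eta>\<close> in \<open>s\<close> gains \<open>l * \<eta> * tot\<close> in the
  exponent, which for large \<open>l\<close> absorbs the bounded loss in
  \<open>H_ratio_bound\<close>, so that \<open>F u\<close> has reached \<open>\<alpha>\<close>
  there.\<close>

lemma q_log_difference:
  assumes \<epsilon>: "\<epsilon> > 0" and \<eta>: "\<eta> > 0"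
  shows "\<exists>y1>0. \<forall>\<alpha> u u'. 0 < \<alpha> \<longrightarrow> \<alpha> \<le> F 1 y1 \<longrightarrow> u \<in> positive_cube \<epsilon> \<longrightarrow> u' \<in> positive_cube \<epsilon> \<longrightarrow>
     ln (q \<alpha> u) \<le> ln (q \<alpha> u') + b \<bullet> (ln_vec u - ln_vec u') / tot + \<eta>"
proof -
  define \<rho> where "\<rho> = real CARD('n) * \<bar>ln \<epsilon>\<bar>"
  \<comment> \<open>A bound for \<open>\<bar>s\<bar>\<close> over all pairs in the cube;
    \<open>R\<close> then contains both centres \<open>\<theta>\<close> and
    \<open>\<theta>'\<close>.\<close>
  define \<sigma> where "\<sigma> = norm b * (2 * \<rho>) / tot + \<eta>"
  define R where "R = \<rho> + norm \<mu> + \<sigma> * norm (1 :: real ^ 'n)"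
  obtain C where C: "C > 0" "\<And>l \<theta> \<theta>'. l \<ge> 1 \<Longrightarrow> norm \<theta> \<le> R \<Longrightarrow> norm \<theta>' \<le> R \<Longrightarrow>
      H (\<theta> + l *\<^sub>R 1) \<ge> exp (- l * (b \<bullet> (\<theta> - \<theta>')) - C * norm (\<theta> - \<theta>')) * H (\<theta>' + l *\<^sub>R 1)"
    using H_ratio_bound[of R] by blast
  define L where "L = max 1 (C * (2 * R) / (\<eta> * tot))"
  have "ln (q \<alpha> u) \<le> ln (q \<alpha> u') + b \<bullet> (ln_vec u - ln_vec u') / tot + \<eta>"
    if \<alpha>: "0 < \<alpha>" "\<alpha> \<le> F 1 (exp (- L))" and u: "u \<in> positive_cube \<epsilon>" and u': "u' \<in> positive_cube \<epsilon>" for \<alpha> u u'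
  proof -
    note up = cube_pos[OF u \<epsilon>] and up' = cube_pos[OF u' \<epsilon>]
    have \<alpha>u: "\<alpha> \<le> F u (exp (- L))" and \<alpha>u': "\<alpha> \<le> F u' (exp (- L))"
      using F_one_le[OF u] F_one_le[OF u'] \<alpha>(2) by (blast intro: order_trans)+
    define y where "y = q \<alpha> u'"
    define l where "l = - ln y"
    define d where "d = b \<bullet> (ln_vec u - ln_vec u')"
    \<comment> \<open>The term \<open>d / tot\<close> cancels
      \<open>b \<bullet> (ln_vec u - ln_vec u')\<close> and leaves
      \<open>b \<bullet> (\<theta> - \<theta>') = - (\<eta> * tot)\<close>.\<close>
    define s where "s = d / tot + \<eta>"
    define \<theta> where "\<theta> = ln_vec u + \<mu> - s *\<^sub>R 1"
    define \<theta>' where "\<theta>' = ln_vec u' + \<mu>"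
    have y: "y > 0" "y \<le> exp (- L)" "\<alpha> \<le> F u' y"
      using q_pos[OF up' \<alpha>(1) \<alpha>u'] q_le[OF up' \<alpha>(1) \<alpha>u' \<alpha>u'] F_q_ge[OF up' \<alpha>(1) \<alpha>u'] by (auto simp: y_def)
    have l: "l \<ge> L" using y ln_le_cancel_iff[of y "exp (- L)"] by (simp add: l_def)
    then have l1: "l \<ge> 1" by (simp add: L_def)
    have n: "norm (ln_vec u) \<le> \<rho>" "norm (ln_vec u') \<le> \<rho>"
      using norm_ln_vec_le[OF u \<epsilon>] norm_ln_vec_le[OF u' \<epsilon>] by (auto simp: \<rho>_def)
    have "norm (ln_vec u - ln_vec u') \<le> 2 * \<rho>" using n norm_triangle_ineq4[of "ln_vec u" "ln_vec u'"] by linarith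
    then have "\<bar>d\<bar> \<le> norm b * (2 * \<rho>)"
      unfolding d_def by (intro order_trans[OF Cauchy_Schwarz_ineq2] mult_left_mono) auto
    then have "\<bar>d / tot\<bar> \<le> norm b * (2 * \<rho>) / tot"
      using tot_pos by (simp add: divide_right_mono)
    then have s: "\<bar>s\<bar> \<le> \<sigma>" unfolding s_def \<sigma>_def using \<eta> by linarith
    then have s1: "norm (s *\<^sub>R (1 :: real ^ 'n)) \<le> \<sigma> * norm (1 :: real ^ 'n)" by (simp add: mult_right_mono)
    have "\<sigma> * norm (1 :: real ^ 'n) \<ge> 0" using s by (intro mult_nonneg_nonneg) auto
    then have n\<theta>': "norm \<theta>' \<le> R"
      using norm_triangle_ineq[of "ln_vec u'" \<mu>] n by (simp add: R_def \<theta>'_def)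
    have n\<theta>: "norm \<theta> \<le> R"
      using norm_triangle_ineq4[of "ln_vec u + \<mu>" "s *\<^sub>R 1"] norm_triangle_ineq[of "ln_vec u" \<mu>] n s1
      unfolding R_def \<theta>_def by linarith
    have "b \<bullet> (\<theta> - \<theta>') = d - s * tot"
      unfolding \<theta>_def \<theta>'_def d_def by (simp add: inner_diff_right inner_add_right b_inner_one)
    also have "\<dots> = - (\<eta> * tot)" using tot_pos by (simp add: s_def field_simps)
    finally have b\<theta>: "b \<bullet> (\<theta> - \<theta>') = - (\<eta> * tot)" .
    have "C * norm (\<theta> - \<theta>') \<le> C * (2 * R)"
      using C norm_triangle_ineq4[of \<theta> \<theta>'] n\<theta> n\<theta>' by (intro mult_left_mono) auto
    also have "\<dots> \<le> l * (\<eta> * tot)"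
    proof -
      have "C * (2 * R) / (\<eta> * tot) \<le> l" using l by (simp add: L_def)
      then show ?thesis using \<eta> tot_pos by (simp add: pos_divide_le_eq)
    qed
    finally have "0 \<le> - l * (b \<bullet> (\<theta> - \<theta>')) - C * norm (\<theta> - \<theta>')" by (simp add: b\<theta>)
    then have "1 * H (\<theta>' + l *\<^sub>R 1) \<le> exp (- l * (b \<bullet> (\<theta> - \<theta>')) - C * norm (\<theta> - \<theta>')) * H (\<theta>' + l *\<^sub>R 1)"
      using H_pos[of "\<theta>' + l *\<^sub>R 1"] by (intro mult_right_mono) auto
    also have "\<dots> \<le> H (\<theta> + l *\<^sub>R 1)" by (rule C(2)[OF l1 n\<theta> n\<theta>'])
    also have "\<dots> = F u (y * exp s)"
      using y by (subst F_eq_H[OF up]) (simp_all add: \<theta>_def l_def ln_mult algebra_simps)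
    also have "H (\<theta>' + l *\<^sub>R 1) = F u' y"
      unfolding \<theta>'_def l_def by (rule F_eq_H[OF up' y(1), symmetric])
    finally have "\<alpha> \<le> F u (y * exp s)" using y(3) by simp
    from q_le[OF up \<alpha>(1) \<alpha>u this] have "ln (q \<alpha> u) \<le> ln (y * exp s)"
      using q_pos[OF up \<alpha>(1) \<alpha>u] y by simp
    also have "\<dots> = ln (q \<alpha> u') + b \<bullet> (ln_vec u - ln_vec u') / tot + \<eta>"
      using y by (simp add: ln_mult y_def[symmetric] s_def d_def)
    finally show ?thesis .
  qed
  then show ?thesis by (intro exI[of _ "exp (- L)"]) auto
qed

text \<open>In logarithmic coordinates the end points are \<open>\<theta> - \<delta>\<close> and
  \<open>\<theta> - \<delta>'\<close> around the midpoint of the portfolios. Concavity of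
  \<open>ln\<close> makes \<open>\<delta> + \<delta>'\<close> nonnegative and of the same order as
  the squares of \<open>\<delta>\<close> and \<open>\<delta>'\<close>, which is what
  \<open>H_second_difference\<close> asks for.\<close>

lemma F_midpoint_less:
  assumes \<epsilon>: "\<epsilon> > 0"
  shows "\<exists>y1>0. \<forall>y u u'. 0 < y \<longrightarrow> y \<le> y1 \<longrightarrow> u \<in> positive_cube \<epsilon> \<longrightarrow> u' \<in> positive_cube \<epsilon> \<longrightarrow> u \<noteq> u' \<longrightarrow>
     2 * F ((1/2) *\<^sub>R (u + u')) y < F u y + F u' y"
proof -
  define R where "R = real CARD('n) * \<bar>ln \<epsilon>\<bar> + norm \<mu>"
  \<comment> \<open>Each of \<open>\<delta> $ i\<close> and \<open>\<delta>' $ i\<close> is at most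
    \<open>\<bar>u $ i - u' $ i\<bar> / (2 * \<epsilon>)\<close>, so their squares add up to at most
    \<open>N * ((u $ i - u' $ i)\<^sup>2 / 4)\<close>.\<close>
  define N where "N = 2 / \<epsilon>\<^sup>2"
  obtain l0 where l0: "\<And>l \<theta> \<delta> \<delta>'. l \<ge> l0 \<Longrightarrow> norm \<theta> \<le> R \<Longrightarrow> (\<And>i. (\<delta> + \<delta>') $ i \<ge> 0) \<Longrightarrow> \<delta> + \<delta>' \<noteq> 0 \<Longrightarrow>
     (norm \<delta>)\<^sup>2 + (norm \<delta>')\<^sup>2 \<le> N * (\<Sum>i\<in>UNIV. (\<delta> + \<delta>') $ i) \<Longrightarrow>
     H (\<theta> - \<delta> + l *\<^sub>R 1) + H (\<theta> - \<delta>' + l *\<^sub>R 1) > 2 * H (\<theta> + l *\<^sub>R 1)"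
    using H_second_difference[of R N] by blast
  have "2 * F ((1/2) *\<^sub>R (u + u')) y < F u y + F u' y"
    if y: "0 < y" "y \<le> exp (- l0)" and u: "u \<in> positive_cube \<epsilon>" and u': "u' \<in> positive_cube \<epsilon>" and ne: "u \<noteq> u'" for y u u'
  proof -
    define m where "m = (1/2) *\<^sub>R (u + u')"
    define l where "l = - ln y"
    define \<theta> where "\<theta> = ln_vec m + \<mu>"
    define \<delta> where "\<delta> = ln_vec m - ln_vec u"
    define \<delta>' where "\<delta>' = ln_vec m - ln_vec u'"
    have ui: "\<epsilon> \<le> u $ i" "u $ i \<le> 1" "\<epsilon> \<le> u' $ i" "u' $ i \<le> 1" for i using u u' by (auto simp: positive_cube_def)
    have mi: "m $ i = (u $ i + u' $ i) / 2" for i by (simp add: m_def)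
    have m: "m \<in> positive_cube \<epsilon>" unfolding positive_cube_def mem_Collect_eq
    proof
      fix i show "\<epsilon> \<le> m $ i \<and> m $ i \<le> 1" using ui[of i] mi[of i] by simp
    qed
    have l: "l \<ge> l0" using y ln_le_cancel_iff[of y "exp (- l0)"] by (simp add: l_def)
    have n\<theta>: "norm \<theta> \<le> R"
      using norm_triangle_ineq[of "ln_vec m" \<mu>] norm_ln_vec_le[OF m \<epsilon>] by (simp add: \<theta>_def R_def)
    have D: "(u $ i - u' $ i)\<^sup>2 / 4 \<le> (\<delta> + \<delta>') $ i" for i
      using ln_second_difference[of "u $ i" "u' $ i"] ui[of i] \<epsilon> by (simp add: \<delta>_def \<delta>'_def mi)
    have D0: "(\<delta> + \<delta>') $ i \<ge> 0" for i using D[of i] zero_le_power2[of "u $ i - u' $ i"] by linarith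
    obtain i where "u $ i \<noteq> u' $ i" using ne by (auto simp: vec_eq_iff)
    then have "(u $ i - u' $ i)\<^sup>2 / 4 > 0" by simp
    then have "(\<delta> + \<delta>') $ i \<noteq> 0" using D[of i] by linarith
    then have D1: "\<delta> + \<delta>' \<noteq> 0" by (metis zero_index)
    have sq: "(\<delta> $ i)\<^sup>2 + (\<delta>' $ i)\<^sup>2 \<le> N * (\<delta> + \<delta>') $ i" for i
    proof -
      have *: "z\<^sup>2 \<le> (u $ i - u' $ i)\<^sup>2 / 4 / \<epsilon>\<^sup>2" if "\<bar>z\<bar> \<le> \<bar>u $ i - u' $ i\<bar> / 2 / \<epsilon>" for z
      proof -
        have "z\<^sup>2 \<le> (\<bar>u $ i - u' $ i\<bar> / 2 / \<epsilon>)\<^sup>2" using power_mono[OF that, of 2] by simp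
        then show ?thesis by (simp add: power_divide)
      qed
      have "\<bar>\<delta> $ i\<bar> \<le> \<bar>m $ i - u $ i\<bar> / \<epsilon>"
        using abs_ln_diff_le[of \<epsilon> "m $ i" "u $ i"] ui[of i] m \<epsilon> by (simp add: \<delta>_def positive_cube_def)
      moreover have "\<bar>\<delta>' $ i\<bar> \<le> \<bar>m $ i - u' $ i\<bar> / \<epsilon>"
        using abs_ln_diff_le[of \<epsilon> "m $ i" "u' $ i"] ui[of i] m \<epsilon> by (simp add: \<delta>'_def positive_cube_def)
      moreover have "\<bar>m $ i - u $ i\<bar> = \<bar>u $ i - u' $ i\<bar> / 2" "\<bar>m $ i - u' $ i\<bar> = \<bar>u $ i - u' $ i\<bar> / 2"
        unfolding mi by (auto simp: abs_if field_simps)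
      ultimately have "(\<delta> $ i)\<^sup>2 + (\<delta>' $ i)\<^sup>2 \<le> N * ((u $ i - u' $ i)\<^sup>2 / 4)"
        using *[of "\<delta> $ i"] *[of "\<delta>' $ i"] by (simp add: N_def)
      also have "\<dots> \<le> N * (\<delta> + \<delta>') $ i" using D[of i] by (intro mult_left_mono) (auto simp: N_def)
      finally show ?thesis .
    qed
    have "(norm \<delta>)\<^sup>2 + (norm \<delta>')\<^sup>2 = (\<Sum>i\<in>UNIV. (\<delta> $ i)\<^sup>2 + (\<delta>' $ i)\<^sup>2)"
      unfolding power2_norm_eq_inner inner_vec_def by (simp add: sum.distrib power2_eq_square)
    also have "\<dots> \<le> N * (\<Sum>i\<in>UNIV. (\<delta> + \<delta>') $ i)"
      unfolding sum_distrib_left by (intro sum_mono sq)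
    finally have "H (\<theta> - \<delta> + l *\<^sub>R 1) + H (\<theta> - \<delta>' + l *\<^sub>R 1) > 2 * H (\<theta> + l *\<^sub>R 1)"
      by (intro l0 l n\<theta> D0 D1)
    moreover have "H (\<theta> - \<delta> + l *\<^sub>R 1) = F u y" "H (\<theta> - \<delta>' + l *\<^sub>R 1) = F u' y" "H (\<theta> + l *\<^sub>R 1) = F m y"
      using F_eq_H[OF cube_pos[OF u \<epsilon>] y(1)] F_eq_H[OF cube_pos[OF u' \<epsilon>] y(1)] F_eq_H[OF cube_pos[OF m \<epsilon>] y(1)]
      by (simp_all add: \<theta>_def \<delta>_def \<delta>'_def l_def algebra_simps)
    ultimately show ?thesis by (simp add: m_def)
  qed
  then show ?thesis by (intro exI[of _ "exp (- l0)"]) auto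
qed

section \<open>Continuity of the quantile and uniqueness of its maximizer\<close>

lemma q_scale:
  assumes "\<And>i. u $ i > 0" "\<And>i. u' $ i > 0" "\<And>i. u $ i \<le> k * u' $ i" "k > 0" "0 < \<alpha>" "\<alpha> \<le> F u y" "\<alpha> \<le> F u' y"
  shows "q \<alpha> u \<le> k * q \<alpha> u'"
proof (rule q_le[OF assms(1,5,6)])
  show "\<alpha> \<le> F u (k * q \<alpha> u')"
    using F_q_ge[of u' \<alpha> y] F_scale[of u k u' "q \<alpha> u'"] assms by force
qed

text \<open>Coordinates are at least \<open>\<epsilon>\<close>, so nearby portfolios dominate each
  other up to the factor \<open>1 + dist u u' / \<epsilon>\<close>. By \<open>q_scale\<close> this
  is a relative bound for quantiles, and \<open>q \<alpha> u' \<le> y\<close> makes it a Lipschitz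
  bound.\<close>

lemma q_continuous_on:
  assumes \<epsilon>: "\<epsilon> > 0" and \<alpha>: "0 < \<alpha>" "\<alpha> \<le> F 1 y"
  shows "continuous_on (positive_cube \<epsilon>) (q \<alpha>)"
proof -
  have *: "q \<alpha> u - q \<alpha> u' \<le> (y / \<epsilon>) * dist u u'" if u: "u \<in> positive_cube \<epsilon>" and u': "u' \<in> positive_cube \<epsilon>" for u u'
  proof -
    note up = cube_pos[OF u \<epsilon>] and up' = cube_pos[OF u' \<epsilon>]
    have \<alpha>u: "\<alpha> \<le> F u y" and \<alpha>u': "\<alpha> \<le> F u' y"
      using F_one_le[OF u] F_one_le[OF u'] \<alpha>(2) by (blast intro: order_trans)+
    have "u $ i \<le> (1 + dist u u' / \<epsilon>) * u' $ i" for i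
    proof -
      have "u $ i - u' $ i \<le> dist u u'"
        using component_le_norm_cart[of "u - u'" i] by (simp add: dist_norm)
      also have "\<dots> \<le> dist u u' / \<epsilon> * u' $ i"
        using u' \<epsilon> mult_left_mono[of \<epsilon> "u' $ i" "dist u u' / \<epsilon>"] by (auto simp: positive_cube_def)
      finally show ?thesis by (simp add: algebra_simps)
    qed
    then have "q \<alpha> u \<le> (1 + dist u u' / \<epsilon>) * q \<alpha> u'"
      using up up' \<alpha>(1) \<alpha>u \<alpha>u' \<epsilon> by (intro q_scale) (auto intro: add_pos_nonneg)
    moreover have "dist u u' / \<epsilon> * q \<alpha> u' \<le> dist u u' / \<epsilon> * y"
      using \<epsilon> q_le[OF up' \<alpha>(1) \<alpha>u' \<alpha>u'] by (intro mult_left_mono) auto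
    ultimately show ?thesis by (simp add: algebra_simps)
  qed
  have "y / \<epsilon> \<ge> 0" using F_nonpos[of 1 y] \<alpha> \<epsilon> by (cases "y \<le> 0") auto
  then have "(y / \<epsilon>)-lipschitz_on (positive_cube \<epsilon>) (q \<alpha>)"
  proof (intro lipschitz_onI)
    fix u u' :: "real ^ 'n" assume "u \<in> positive_cube \<epsilon>" "u' \<in> positive_cube \<epsilon>"
    then show "dist (q \<alpha> u) (q \<alpha> u') \<le> (y / \<epsilon>) * dist u u'"
      using *[of u u'] *[of u' u] by (simp add: dist_real_def abs_le_iff dist_commute[of u' u])
  qed
  then show ?thesis by (rule lipschitz_on_continuous_on)
qed

lemma q_unique_maximizer:
  assumes \<epsilon>: "\<epsilon> > 0"
  shows "\<exists>y1>0. \<forall>\<alpha> T. 0 < \<alpha> \<longrightarrow> \<alpha> \<le> F 1 y1 \<longrightarrow> T \<subseteq> positive_cube \<epsilon> \<longrightarrow> compact T \<longrightarrow> convex T \<longrightarrow> T \<noteq> {} \<longrightarrow>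
     (\<exists>!u. is_arg_max (q \<alpha>) (\<lambda>u. u \<in> T) u)"
proof -
  obtain y0 where y0: "y0 > 0" and mid: "\<And>y u u'. 0 < y \<Longrightarrow> y \<le> y0 \<Longrightarrow> u \<in> positive_cube \<epsilon> \<Longrightarrow> u' \<in> positive_cube \<epsilon> \<Longrightarrow> u \<noteq> u' \<Longrightarrow>
     2 * F ((1/2) *\<^sub>R (u + u')) y < F u y + F u' y"
    using F_midpoint_less[OF \<epsilon>] by blast
  \<comment> \<open>The quantiles stay below \<open>y1\<close>: \<open>y0\<close> admits
    \<open>mid\<close> at their level, and \<open>exp (- 1)\<close> admits
    \<open>F_q_eq\<close>.\<close>
  define y1 where "y1 = min y0 (exp (- 1))"
  have "\<exists>!u. is_arg_max (q \<alpha>) (\<lambda>u. u \<in> T) u"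
    if \<alpha>: "0 < \<alpha>" "\<alpha> \<le> F 1 y1" and T: "T \<subseteq> positive_cube \<epsilon>" "compact T" "convex T" "T \<noteq> {}" for \<alpha> T
  proof -
    have up: "u $ i > 0" if "u \<in> T" for u i using T(1) that cube_pos[OF _ \<epsilon>] by blast
    have \<alpha>u: "\<alpha> \<le> F u y1" if "u \<in> T" for u using F_one_le[of u \<epsilon> y1] T(1) that \<alpha>(2) by force
    have "continuous_on T (q \<alpha>)" using q_continuous_on[OF \<epsilon> \<alpha>] T(1) by (rule continuous_on_subset)
    from continuous_attains_sup[OF T(2) T(4) this] obtain u where u: "u \<in> T" "\<And>v. v \<in> T \<Longrightarrow> q \<alpha> v \<le> q \<alpha> u" by blast
    have max: "is_arg_max (q \<alpha>) (\<lambda>u. u \<in> T) v \<longleftrightarrow> v \<in> T \<and> q \<alpha> v = q \<alpha> u" for v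
      unfolding is_arg_max_def using u by (metis antisym_conv2 not_less)
    have "u = v" if v: "v \<in> T" "q \<alpha> v = q \<alpha> u" for v
    proof (rule ccontr)
      assume ne: "u \<noteq> v"
      \<comment> \<open>At the maximal level \<open>q \<alpha> u\<close> both end points have
        probability exactly \<open>\<alpha>\<close>, and the midpoint has at least
        \<open>\<alpha>\<close> because its quantile is not larger. This contradicts strict midpoint
        convexity.\<close>
      define m where "m = (1/2) *\<^sub>R (u + v)"
      have m: "m \<in> T" using convexD[OF T(3) u(1) v(1), of "1/2" "1/2"] by (simp add: m_def scaleR_add_right)
      have k: "q \<alpha> u \<le> y1" "0 < q \<alpha> u"
        using q_le[OF up[OF u(1)] \<alpha>(1) \<alpha>u[OF u(1)] \<alpha>u[OF u(1)]] q_pos[OF up[OF u(1)] \<alpha>(1) \<alpha>u[OF u(1)]] by auto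
      have Fk: "F w (q \<alpha> u) = \<alpha>" if "w \<in> T" "q \<alpha> w = q \<alpha> u" for w
        using F_q_eq[OF up[OF that(1)] \<alpha>(1) \<alpha>u[OF that(1)]] that(2) k(1) by (simp add: y1_def)
      have "\<alpha> \<le> F m (q \<alpha> m)" by (rule F_q_ge[OF up[OF m] \<alpha>(1) \<alpha>u[OF m]])
      also have "\<dots> \<le> F m (q \<alpha> u)" by (rule F_mono[OF u(2)[OF m]])
      finally have "2 * \<alpha> \<le> 2 * F m (q \<alpha> u)" by simp
      also have "\<dots> < F u (q \<alpha> u) + F v (q \<alpha> u)"
        unfolding m_def using k u v T(1) ne by (intro mid) (auto simp: y1_def)
      finally show False using Fk[OF u(1) refl] Fk[OF v] by simp
    qed
    then show ?thesis using u(1) unfolding max by metis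
  qed
  then show ?thesis using y0 by (intro exI[of _ y1]) (auto simp: y1_def)
qed

end

section \<open>Relative entropy and the truncated simplex\<close>

text \<open>A quantitative Gibbs inequality by way of the Hellinger distance:
  \<open>w * (ln w - ln u)\<close> is at least \<open>2 * w - 2 * sqrt (w * u)\<close>, which is
  \<open>w - u\<close> plus the square of \<open>sqrt w - sqrt u\<close>. That square is at least
  \<open>(w - u)\<^sup>2 / 4\<close> because \<open>sqrt w + sqrt u \<le> 2\<close>.\<close>

lemma relative_entropy_term_ge:
  fixes w u :: real
  assumes "0 < w" "w \<le> 1" "0 < u" "u \<le> 1"
  shows "(w - u)\<^sup>2 / 4 + (w - u) \<le> w * (ln w - ln u)"
proof -
  define a where "a = sqrt w"
  define c where "c = sqrt u"
  have a: "0 < a" "a \<le> 1" "w = a\<^sup>2" and c: "0 < c" "c \<le> 1" "u = c\<^sup>2"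
    using assms by (simp_all add: a_def c_def)
  have "ln c - ln a \<le> c / a - 1"
    using ln_le_minus_one[of "c / a"] a c by (simp add: ln_div)
  then have "a\<^sup>2 * (ln c - ln a) \<le> a\<^sup>2 * (c / a - 1)" by (intro mult_left_mono) auto
  also have "\<dots> = a * c - a\<^sup>2" using a by (simp add: field_simps power2_eq_square)
  finally have 1: "2 * a\<^sup>2 - 2 * (a * c) \<le> a\<^sup>2 * (2 * ln a - 2 * ln c)" by (simp add: algebra_simps)
  have "(a + c)\<^sup>2 \<le> 2\<^sup>2" using a c by (intro power_mono) auto
  then have "(a - c)\<^sup>2 * (a + c)\<^sup>2 \<le> (a - c)\<^sup>2 * 4" by (intro mult_left_mono) auto
  also have "(a - c)\<^sup>2 * (a + c)\<^sup>2 = (w - u)\<^sup>2"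
    unfolding a(3) c(3) by (simp add: power2_eq_square algebra_simps)
  also have "(a - c)\<^sup>2 = w + u - 2 * (a * c)" unfolding a(3) c(3) by (simp add: power2_diff)
  finally have "(w - u)\<^sup>2 / 4 + (w - u) \<le> 2 * w - 2 * (a * c)" by (simp add: field_simps)
  with 1 show ?thesis using a(1) c(1) unfolding a(3) c(3) by (simp add: ln_realpow)
qed

text \<open>The set of portfolios in the theorem, written symmetrically in all coordinates: the
  bound on the last one encodes \<open>(\<Sum>i\<in>UNIV. t $ i) \<le> 1 - \<epsilon>\<close>
  (\<open>image_simplex_param\<close>).\<close>

definition simplex_above :: "real \<Rightarrow> (real ^ 'n) set" where
  "simplex_above \<epsilon> = {u. (\<forall>i. \<epsilon> \<le> u $ i) \<and> (\<Sum>i\<in>UNIV. u $ i) = 1}"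

lemma simplex_above_subset_cube:
  assumes "\<epsilon> > 0" shows "simplex_above \<epsilon> \<subseteq> positive_cube \<epsilon>"
proof
  fix u :: "real ^ 'n" assume u: "u \<in> simplex_above \<epsilon>"
  have "u $ i \<le> (\<Sum>i\<in>UNIV. u $ i)" for i
    using u assms by (intro member_le_sum) (auto simp: simplex_above_def intro: order_trans less_imp_le)
  then show "u \<in> positive_cube \<epsilon>" using u by (auto simp: simplex_above_def positive_cube_def)
qed

lemma compact_simplex_above:
  assumes "\<epsilon> > 0" shows "compact (simplex_above \<epsilon> :: (real ^ 'n) set)"
proof -
  have "positive_cube \<epsilon> \<subseteq> cbox 0 (1 :: real ^ 'n)"
  proof
    fix u :: "real ^ 'n" assume "u \<in> positive_cube \<epsilon>"
    then have "\<epsilon> \<le> u $ i \<and> u $ i \<le> 1" for i by (simp add: positive_cube_def)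
    then show "u \<in> cbox 0 1" using assms by (auto simp: mem_box_cart) (meson less_imp_le order_trans)
  qed
  then have "bounded (simplex_above \<epsilon> :: (real ^ 'n) set)"
    using simplex_above_subset_cube[OF assms] by (meson bounded_cbox bounded_subset)
  moreover have "closed (simplex_above \<epsilon> :: (real ^ 'n) set)"
    unfolding simplex_above_def
    by (intro closed_Collect_conj closed_Collect_all closed_Collect_le closed_Collect_eq continuous_intros)
  ultimately show ?thesis by (simp add: compact_eq_bounded_closed)
qed

lemma convex_simplex_above: "convex (simplex_above \<epsilon>)"
proof (rule convexI)
  fix x y :: "real ^ 'n" and s t :: real
  assume x: "x \<in> simplex_above \<epsilon>" and y: "y \<in> simplex_above \<epsilon>" and st: "0 \<le> s" "0 \<le> t" "s + t = 1"
  have "\<epsilon> \<le> s * x $ i + t * y $ i" for i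
  proof -
    have "s * \<epsilon> + t * \<epsilon> \<le> s * x $ i + t * y $ i"
      using x y st by (intro add_mono mult_left_mono) (auto simp: simplex_above_def)
    then show ?thesis using st by (simp flip: distrib_right)
  qed
  moreover have "(\<Sum>i\<in>UNIV. s * x $ i + t * y $ i) = 1"
    using x y st by (simp add: simplex_above_def sum.distrib flip: sum_distrib_left)
  ultimately show "s *\<^sub>R x + t *\<^sub>R y \<in> simplex_above \<epsilon>" by (simp add: simplex_above_def)
qed

lemma sum_UNIV_option: "(\<Sum>j\<in>(UNIV :: 'm::finite option set). f j) = f None + (\<Sum>i\<in>UNIV. f (Some i))"
  by (simp add: UNIV_option_conv sum.reindex)

lemma simplex_param_Some [simp]: "simplex_param t $ Some i = t $ i"
  and simplex_param_None [simp]: "simplex_param t $ None = 1 - (\<Sum>i\<in>UNIV. t $ i)"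
  by (simp_all add: simplex_param_def)

lemma simplex_param_of_simplex:
  assumes "(\<Sum>j\<in>UNIV. u $ j) = 1" shows "simplex_param (\<chi> i. u $ Some i) = u"
  using assms by (auto simp: vec_eq_iff simplex_param_def sum_UNIV_option split: option.split)

lemma simplex_param_in_simplex_above: "simplex_param t \<in> simplex_above \<epsilon> \<longleftrightarrow> t \<in> trunc_simplex \<epsilon>"
  by (auto simp: simplex_above_def trunc_simplex_def sum_UNIV_option split_option_all)

lemma image_simplex_param:
  fixes \<epsilon> :: real
  shows "simplex_param ` (trunc_simplex \<epsilon> :: (real ^ 'm) set) = simplex_above \<epsilon>"
proof
  show "simplex_param ` (trunc_simplex \<epsilon> :: (real ^ 'm) set) \<subseteq> simplex_above \<epsilon>" using simplex_param_in_simplex_above by blast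
  show "simplex_above \<epsilon> \<subseteq> simplex_param ` (trunc_simplex \<epsilon> :: (real ^ 'm) set)"
  proof
    fix u :: "real ^ 'm option" assume u: "u \<in> simplex_above \<epsilon>"
    then have *: "simplex_param (\<chi> i. u $ Some i) = u"
      by (intro simplex_param_of_simplex) (simp add: simplex_above_def)
    then have "(\<chi> i. u $ Some i) \<in> trunc_simplex \<epsilon>" using u simplex_param_in_simplex_above by metis
    then show "u \<in> simplex_param ` trunc_simplex \<epsilon>" using * by (metis imageI)
  qed
qed

context gaussian_density
begin

definition peak :: "real ^ 'n" where
  "peak = (1 / tot) *\<^sub>R b"

text \<open>The logarithm of the limit profile. On the simplex it is minus the relative entropy of
  \<open>peak\<close> with respect to \<open>u\<close>.\<close>

definition profile :: "real ^ 'n \<Rightarrow> real" where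
  "profile u = b \<bullet> (ln_vec u - ln_vec peak) / tot"

lemma sum_peak: "(\<Sum>i\<in>UNIV. peak $ i) = 1"
  using tot_pos by (simp add: peak_def tot_def flip: sum_divide_distrib)

lemma peak_pos: "peak $ i > 0"
  using tot_pos b_pos by (simp add: peak_def)

text \<open>The linear terms of \<open>relative_entropy_term_ge\<close> cancel, as both vectors sum
  to 1. The quadratic gap turns a nearly maximal profile into closeness to
  \<open>peak\<close>.\<close>

lemma profile_le:
  assumes "u \<in> simplex_above \<epsilon>" "peak \<in> simplex_above \<epsilon>" "\<epsilon> > 0"
  shows "profile u \<le> - (dist u peak)\<^sup>2 / 4"
proof -
  have u: "0 < u $ i" "u $ i \<le> 1" and p: "peak $ i \<le> 1" for i
    using subsetD[OF simplex_above_subset_cube[OF assms(3)] assms(1)]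
      subsetD[OF simplex_above_subset_cube[OF assms(3)] assms(2)] assms(3)
    by (auto simp: positive_cube_def intro: less_le_trans)
  have "(\<Sum>i\<in>UNIV. (peak $ i - u $ i)\<^sup>2 / 4 + (peak $ i - u $ i)) \<le> (\<Sum>i\<in>UNIV. peak $ i * (ln (peak $ i) - ln (u $ i)))"
    using u p peak_pos by (intro sum_mono relative_entropy_term_ge) auto
  also have "\<dots> = - profile u"
    using tot_pos by (simp add: profile_def inner_vec_def peak_def sum_divide_distrib sum_negf[symmetric] algebra_simps diff_divide_distrib)
  also have "(\<Sum>i\<in>UNIV. (peak $ i - u $ i)\<^sup>2 / 4 + (peak $ i - u $ i)) = (\<Sum>i\<in>UNIV. (peak $ i - u $ i)\<^sup>2) / 4"
    using assms(1) sum_peak by (simp add: sum.distrib sum_subtractf simplex_above_def sum_divide_distrib)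
  also have "(\<Sum>i\<in>UNIV. (peak $ i - u $ i)\<^sup>2) = (dist u peak)\<^sup>2"
    unfolding dist_norm power2_norm_eq_inner inner_vec_def by (simp add: power2_eq_square algebra_simps)
  finally show ?thesis by simp
qed

end

section \<open>Convergence of the maximizers and of the normalised quantile\<close>

text \<open>Since \<open>ustar \<alpha>\<close> moves with \<open>\<alpha>\<close>, the comparison
  of logarithms must be uniform in both portfolios. Used against \<open>peak\<close> it gives the
  limit of \<open>ustar\<close>; used against a fixed \<open>u\<close> it gives the ratio.\<close>

lemma (in lognormal_portfolio) q_maximizer_asymptotics:
  assumes \<epsilon>: "\<epsilon> > 0" and peak: "peak \<in> simplex_above \<epsilon>"
    and max: "\<forall>\<^sub>F \<alpha> in at_right 0. is_arg_max (q \<alpha>) (\<lambda>u. u \<in> simplex_above \<epsilon>) (ustar \<alpha>)"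
  shows "(ustar \<longlongrightarrow> peak) (at_right 0)"
    and "u \<in> simplex_above \<epsilon> \<Longrightarrow>
      ((\<lambda>\<alpha>. q \<alpha> u / (q \<alpha> (ustar \<alpha>) * exp (profile u))) \<longlongrightarrow> 1) (at_right 0)"
proof -
  let ?S = "simplex_above \<epsilon> :: (real ^ 'n) set"
  note cube = subsetD[OF simplex_above_subset_cube[OF \<epsilon>]]
  have small: "\<forall>\<^sub>F \<alpha> in at_right 0. 0 < \<alpha> \<and> \<alpha> \<le> F 1 y" if "y > 0" for y
    using F_one_pos[OF that] by (auto simp: eventually_at_right_field intro!: exI[of _ "F 1 y"])
  have pos: "q \<alpha> v > 0" if "0 < \<alpha>" "\<alpha> \<le> F 1 y" "v \<in> ?S" for \<alpha> v y
    using F_one_le[OF cube[OF that(3)], of y] that by (intro q_pos[of v \<alpha> y] cube_pos[OF cube \<epsilon>]) auto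
  have diff: "\<forall>\<^sub>F \<alpha> in at_right 0. \<forall>v\<in>?S. \<forall>v'\<in>?S. ln (q \<alpha> v) \<le> ln (q \<alpha> v') + (profile v - profile v') + \<eta>"
    if \<eta>: "\<eta> > 0" for \<eta>
  proof -
    obtain y1 where y1: "y1 > 0" "\<And>\<alpha> u u'. 0 < \<alpha> \<Longrightarrow> \<alpha> \<le> F 1 y1 \<Longrightarrow> u \<in> positive_cube \<epsilon> \<Longrightarrow> u' \<in> positive_cube \<epsilon> \<Longrightarrow>
        ln (q \<alpha> u) \<le> ln (q \<alpha> u') + b \<bullet> (ln_vec u - ln_vec u') / tot + \<eta>"
      using q_log_difference[OF \<epsilon> \<eta>] by blast
    have "b \<bullet> (ln_vec v - ln_vec v') / tot = profile v - profile v'" for v v'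
      by (simp add: profile_def inner_diff_right diff_divide_distrib)
    with small[OF y1(1)] show ?thesis
      by (rule_tac eventually_mono) (use y1(2) cube in fastforce)+
  qed
  have star: "\<forall>\<^sub>F \<alpha> in at_right 0. ustar \<alpha> \<in> ?S \<and> (\<forall>v\<in>?S. q \<alpha> v \<le> q \<alpha> (ustar \<alpha>)) \<and> (\<forall>v\<in>?S. q \<alpha> v > 0)"
    using max small[OF zero_less_one] by eventually_elim (auto simp: is_arg_max_def not_less intro: pos)
  \<comment> \<open>Compare with \<open>peak\<close>, whose profile is 0: its quantile cannot exceed
    the maximal one, so the profile at the maximizer falls short by at most the error
    \<open>\<eta>\<close>.\<close>
  have prof: "\<forall>\<^sub>F \<alpha> in at_right 0. ustar \<alpha> \<in> ?S \<and> - \<eta> \<le> profile (ustar \<alpha>)" if \<eta>: "\<eta> > 0" for \<eta>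
    using star diff[OF \<eta>]
  proof eventually_elim
    case (elim \<alpha>)
    then have "ln (q \<alpha> (ustar \<alpha>)) \<le> ln (q \<alpha> peak) + (profile (ustar \<alpha>) - profile peak) + \<eta>"
      using peak by blast
    moreover have "ln (q \<alpha> peak) \<le> ln (q \<alpha> (ustar \<alpha>))" using elim peak by simp
    moreover have "profile peak = 0" by (simp add: profile_def)
    ultimately show ?case using elim by simp
  qed
  show "(ustar \<longlongrightarrow> peak) (at_right 0)"
  proof (rule tendstoI)
    fix e :: real assume e: "e > 0"
    \<comment> \<open>By \<open>profile_le\<close>, a profile of at least
      \<open>- e\<^sup>2 / 8\<close> forces a squared distance of at most
      \<open>e\<^sup>2 / 2\<close>.\<close>
    then have "e\<^sup>2 / 8 > 0" by simp
    from prof[OF this] show "\<forall>\<^sub>F \<alpha> in at_right 0. dist (ustar \<alpha>) peak < e"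
    proof eventually_elim
      case (elim \<alpha>)
      then have "(dist (ustar \<alpha>) peak)\<^sup>2 \<le> e\<^sup>2 / 2" using profile_le[OF _ peak \<epsilon>, of "ustar \<alpha>"] by auto
      also have "\<dots> < e\<^sup>2" using e by simp
      finally show ?case by (rule power2_less_imp_less) (use e in simp)
    qed
  qed
  assume u: "u \<in> ?S"
  let ?r = "\<lambda>\<alpha>. ln (q \<alpha> u) - ln (q \<alpha> (ustar \<alpha>)) - profile u"
  have "(?r \<longlongrightarrow> 0) (at_right 0)"
  proof (rule tendstoI)
    fix e :: real assume "e > 0"
    \<comment> \<open>Spent at most twice: on the uniform comparison, and on the profile of the
      maximizer, which lies between \<open>- e / 3\<close> and 0.\<close>
    then have e: "e / 3 > 0" by simp
    from star diff[OF e] prof[OF e] show "\<forall>\<^sub>F \<alpha> in at_right 0. dist (?r \<alpha>) 0 < e"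
    proof eventually_elim
      case (elim \<alpha>)
      then have "ln (q \<alpha> u) \<le> ln (q \<alpha> (ustar \<alpha>)) + (profile u - profile (ustar \<alpha>)) + e / 3"
        "ln (q \<alpha> (ustar \<alpha>)) \<le> ln (q \<alpha> u) + (profile (ustar \<alpha>) - profile u) + e / 3"
        using u by blast+
      moreover have "profile (ustar \<alpha>) \<le> 0"
        using profile_le[OF _ peak \<epsilon>, of "ustar \<alpha>"] elim zero_le_power2[of "dist (ustar \<alpha>) peak"] by linarith
      ultimately show ?case using elim e unfolding dist_real_def abs_less_iff by linarith
    qed
  qed
  then have "((\<lambda>\<alpha>. exp (?r \<alpha>)) \<longlongrightarrow> exp 0) (at_right 0)" by (rule tendsto_exp)
  moreover have "\<forall>\<^sub>F \<alpha> in at_right 0. exp (?r \<alpha>) = q \<alpha> u / (q \<alpha> (ustar \<alpha>) * exp (profile u))"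
    using star by eventually_elim (use u in \<open>simp add: exp_diff\<close>)
  ultimately show "((\<lambda>\<alpha>. q \<alpha> u / (q \<alpha> (ustar \<alpha>) * exp (profile u))) \<longlongrightarrow> 1) (at_right 0)"
    using Lim_transform_eventually by fastforce
qed

section \<open>From the normal law to the theorem\<close>

lemma sym_pos_def_inverse_sym:
  assumes "sym_pos_def A" shows "transpose (matrix_inv A) = matrix_inv A"
proof -
  have "inj ((*v) A)"
  proof (rule injI, rule ccontr)
    fix x y assume "A *v x = A *v y" "x \<noteq> y"
    then have "(x - y) \<bullet> (A *v (x - y)) = 0" "x - y \<noteq> 0" by (auto simp: matrix_vector_mult_diff_distrib)
    then show False using assms unfolding sym_pos_def_def by (metis less_irrefl)
  qed
  then have "\<exists>A'. A' ** A = mat 1" by (simp add: matrix_left_invertible_injective)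
  then have inv: "invertible A" by (simp add: invertible_left_inverse)
  have l: "matrix_inv A ** A = mat 1" and r: "A ** matrix_inv A = mat 1"
    using someI_ex[OF inv[unfolded invertible_def]] by (auto simp: matrix_inv_def)
  have "transpose (matrix_inv A) ** A = mat 1"
    using r assms by (metis matrix_transpose_mul sym_pos_def_def transpose_mat)
  then have "transpose (matrix_inv A) ** A ** matrix_inv A = matrix_inv A" by simp
  then show ?thesis by (simp add: r flip: matrix_mul_assoc)
qed

text \<open>The total mass of the centred density is the probability that \<open>Z\<close> takes
  some value, hence 1, by translation.\<close>

lemma lognormal_portfolioI:
  fixes A :: "real ^ 'n ^ 'n" and b :: "real ^ 'n"
  assumes M: "prob_space M" and A: "sym_pos_def A" and B: "B = matrix_inv A"
    and Z: "multivariate_normal M Z \<mu> A"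
    and X: "\<And>\<omega> i. \<omega> \<in> space M \<Longrightarrow> X \<omega> $ i = exp (Z \<omega> $ i)"
    and b: "\<And>i. b $ i = (\<Sum>j\<in>UNIV. B $ j $ i)" and b_pos: "\<And>k. b $ k > 0"
  shows "lognormal_portfolio B b (1 / sqrt ((2 * pi) ^ CARD('n) * det A)) M Z X \<mu>"
proof -
  interpret prob_space M by (rule M)
  define c where "c = 1 / sqrt ((2 * pi) ^ CARD('n) * det A)"
  define g where "g z = c * exp (- (z \<bullet> (B *v z)) / 2)" for z
  have sym: "transpose B = B" unfolding B by (rule sym_pos_def_inverse_sym[OF A])
  have "mvn_density \<mu> A z = g (z - \<mu>)" for z by (simp add: mvn_density_def g_def c_def B)
  then have D: "distributed M lborel Z (\<lambda>z. ennreal (g (z - \<mu>)))"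
    using Z by (simp add: multivariate_normal_def)
  have g_meas [measurable]: "g \<in> borel_measurable borel"
    unfolding g_def by (intro borel_measurable_continuous_onI continuous_intros matrix_vector_mult_linear_continuous_on) simp
  have "(\<integral>\<^sup>+z. ennreal (g z) \<partial>lborel) = (\<integral>\<^sup>+z. ennreal (g z) \<partial>distr lborel borel ((+) (- \<mu>)))"
    by (simp add: lborel_distr_plus)
  also have "\<dots> = (\<integral>\<^sup>+z. ennreal (g (z - \<mu>)) \<partial>lborel)"
    by (subst nn_integral_distr) (auto simp: algebra_simps)
  also have "\<dots> = emeasure M (Z -` UNIV \<inter> space M)"
    using distributed_emeasure[OF D, of UNIV] by simp
  finally have total: "(\<integral>\<^sup>+z. ennreal (g z) \<partial>lborel) = 1" by (simp add: emeasure_space_1)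
  \<comment> \<open>Otherwise \<open>ennreal\<close> would truncate the density to 0 everywhere,
    against total mass 1. This replaces a computation of the sign of \<open>det A\<close>.\<close>
  have "c > 0"
  proof (rule ccontr)
    assume "\<not> c > 0"
    then have "ennreal (g z) = 0" for z by (simp add: g_def ennreal_neg mult_nonpos_nonneg)
    with total show False by simp
  qed
  moreover have "B *v 1 = b"
  proof -
    \<comment> \<open>The vector \<open>b\<close> consists of column sums, \<open>B *v 1\<close> of
      row sums.\<close>
    have "B $ i $ j = B $ j $ i" for i j by (metis sym transpose_def vec_lambda_beta)
    then show ?thesis by (simp add: vec_eq_iff matrix_vector_mult_def b)
  qed
  ultimately have G: "gaussian_density B b c"
    using sym b_pos total by unfold_locales (auto simp: g_def)
  have "distributed M lborel Z (\<lambda>z. ennreal (gaussian_density.dens B c (z - \<mu>)))"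
    using D by (simp add: gaussian_density.dens_def[OF G] g_def)
  then show ?thesis
    unfolding lognormal_portfolio_def lognormal_portfolio_axioms_def c_def[symmetric] using G M X by simp
qed

theorem mainTheorem4:
  fixes M :: "'a measure"
    and Z X :: "'a \<Rightarrow> real ^ ('m::finite) option"
    and \<mu> b :: "real ^ 'm option"
    and A B :: "real ^ 'm option ^ 'm option"
    and \<beta> :: real
  assumes "prob_space M"
    and "sym_pos_def A"
    and "B = matrix_inv A"
    and "multivariate_normal M Z \<mu> A"
    and "\<And>\<omega> i. \<omega> \<in> space M \<Longrightarrow> X \<omega> $ i = exp (Z \<omega> $ i)"
    and "\<And>i. b $ i = (\<Sum>j\<in>UNIV. B $ j $ i)"
    and "\<beta> = (\<Sum>i\<in>UNIV. b $ i)"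
    and "\<And>k. b $ k > 0"
  shows "\<forall>\<^sub>F \<epsilon> in at_right 0. \<exists>tstar :: real \<Rightarrow> real ^ 'm.
    (\<forall>\<^sub>F \<alpha> in at_right 0.
       tstar \<alpha> \<in> trunc_simplex \<epsilon> \<and>
       (\<forall>u. is_arg_max (portfolio_quantile M X \<alpha>) (\<lambda>u. u \<in> simplex_param ` trunc_simplex \<epsilon>) u
            \<longleftrightarrow> u = simplex_param (tstar \<alpha>))) \<and>
    (tstar \<longlongrightarrow> (\<chi> i. b $ Some i / \<beta>)) (at_right 0) \<and>
    (\<forall>t \<in> trunc_simplex \<epsilon>.
       ((\<lambda>\<alpha>. portfolio_quantile M X \<alpha> (simplex_param t) /
             (portfolio_quantile M X \<alpha> (simplex_param (tstar \<alpha>)) * limit_profile b \<beta> t))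
          \<longlongrightarrow> 1) (at_right 0))"
proof -
  interpret lognormal_portfolio B b "1 / sqrt ((2 * pi) ^ CARD('m option) * det A)" M Z X \<mu>
    by (rule lognormal_portfolioI) fact+
  have tot: "tot = \<beta>" by (simp add: tot_def assms(7))
  \<comment> \<open>Here "sufficiently small" means that the truncated simplex contains the
    peak.\<close>
  have "\<forall>\<^sub>F \<epsilon> in at_right 0. 0 < \<epsilon> \<and> (\<forall>j. \<epsilon> \<le> peak $ j)"
  proof -
    have "\<forall>\<^sub>F \<epsilon> in at_right 0. \<epsilon> \<le> peak $ j" for j
      using peak_pos[of j] by (auto simp: eventually_at_right_field intro!: exI[of _ "peak $ j"])
    then have "\<forall>\<^sub>F \<epsilon> in at_right 0. \<forall>j. \<epsilon> \<le> peak $ j" by (rule eventually_all_finite)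
    then show ?thesis using eventually_at_right_less[of "0 :: real"] by eventually_elim auto
  qed
  then show ?thesis
  proof eventually_elim
    case (elim \<epsilon>)
    then have \<epsilon>: "\<epsilon> > 0" and peak: "peak \<in> simplex_above \<epsilon>" by (auto simp: simplex_above_def sum_peak)
    let ?max = "\<lambda>\<alpha>. is_arg_max (q \<alpha>) (\<lambda>u. u \<in> simplex_above \<epsilon>)"
    obtain y1 where y1: "y1 > 0" and uniq: "\<And>\<alpha>. 0 < \<alpha> \<Longrightarrow> \<alpha> \<le> F 1 y1 \<Longrightarrow> \<exists>!u. ?max \<alpha> u"
      using q_unique_maximizer[OF \<epsilon>] simplex_above_subset_cube[OF \<epsilon>] compact_simplex_above[OF \<epsilon>] convex_simplex_above peak
      by (metis empty_iff)
    \<comment> \<open>For \<open>\<alpha>\<close> outside the range of \<open>uniq\<close> this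
      value may be unspecified; all claims concern \<open>\<alpha>\<close> near 0 only.\<close>
    define ustar where "ustar \<alpha> = (THE u. ?max \<alpha> u)" for \<alpha>
    define tstar :: "real \<Rightarrow> real ^ 'm" where "tstar \<alpha> = (\<chi> i. ustar \<alpha> $ Some i)" for \<alpha>
    have ev: "\<forall>\<^sub>F \<alpha> in at_right 0. \<forall>u. ?max \<alpha> u \<longleftrightarrow> u = ustar \<alpha>"
    proof -
      have "\<forall>\<^sub>F \<alpha> in at_right 0. 0 < \<alpha> \<and> \<alpha> \<le> F 1 y1"
        using F_one_pos[OF y1] by (auto simp: eventually_at_right_field intro!: exI[of _ "F 1 y1"])
      then show ?thesis
      proof eventually_elim
        case (elim \<alpha>)
        then have "\<exists>!u. ?max \<alpha> u" by (intro uniq) auto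
        from theI'[OF this] this show ?case unfolding ustar_def by blast
      qed
    qed
    have star: "\<forall>\<^sub>F \<alpha> in at_right 0. simplex_param (tstar \<alpha>) = ustar \<alpha> \<and> ustar \<alpha> \<in> simplex_above \<epsilon>"
      using ev
    proof eventually_elim
      case (elim \<alpha>)
      then have "ustar \<alpha> \<in> simplex_above \<epsilon>" by (auto simp: is_arg_max_def)
      then show ?case unfolding tstar_def by (auto simp: simplex_above_def intro!: simplex_param_of_simplex)
    qed
    have "\<forall>\<^sub>F \<alpha> in at_right 0. ?max \<alpha> (ustar \<alpha>)" using ev by eventually_elim simp
    note asym = q_maximizer_asymptotics[OF \<epsilon> peak this]
    show ?case
    proof (intro exI[of _ tstar] conjI ballI)
      show "\<forall>\<^sub>F \<alpha> in at_right 0. tstar \<alpha> \<in> trunc_simplex \<epsilon> \<and>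
          (\<forall>u. is_arg_max (q \<alpha>) (\<lambda>u. u \<in> simplex_param ` trunc_simplex \<epsilon>) u \<longleftrightarrow> u = simplex_param (tstar \<alpha>))"
        using ev star unfolding image_simplex_param
        by eventually_elim (metis simplex_param_in_simplex_above)
      show "(tstar \<longlongrightarrow> (\<chi> i. b $ Some i / \<beta>)) (at_right 0)"
      proof (rule vec_tendstoI)
        fix i
        have "((\<lambda>\<alpha>. ustar \<alpha> $ Some i) \<longlongrightarrow> peak $ Some i) (at_right 0)" by (rule tendsto_vec_nth[OF asym(1)])
        then show "((\<lambda>\<alpha>. tstar \<alpha> $ i) \<longlongrightarrow> (\<chi> i. b $ Some i / \<beta>) $ i) (at_right 0)"
          by (simp add: tstar_def peak_def tot)
      qed
      fix t :: "real ^ 'm" assume t: "t \<in> trunc_simplex \<epsilon>"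
      then have u: "simplex_param t \<in> simplex_above \<epsilon>" by (simp add: simplex_param_in_simplex_above)
      have "limit_profile b \<beta> t = exp (profile (simplex_param t))"
      proof -
        have u0: "simplex_param t $ j > 0" for j
          using u \<epsilon> by (auto simp: simplex_above_def simp del: split_option_all intro: less_le_trans)
        have \<beta>: "\<beta> > 0" using tot_pos tot by simp
        have ln: "ln (\<beta> * simplex_param t $ j / b $ j) = ln (simplex_param t $ j) - ln (peak $ j)" for j
          using u0[of j] \<beta> assms(8)[of j] by (simp add: peak_def tot ln_div ln_mult)
        have "limit_profile b \<beta> t = exp (1 / \<beta> * (\<Sum>j\<in>UNIV. b $ j * ln (\<beta> * simplex_param t $ j / b $ j)))"
          by (simp add: limit_profile_def sum_UNIV_option add.commute)
        then show ?thesis unfolding ln by (simp add: profile_def tot inner_vec_def)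
      qed
      moreover have "\<forall>\<^sub>F \<alpha> in at_right 0. q \<alpha> (simplex_param t) / (q \<alpha> (ustar \<alpha>) * exp (profile (simplex_param t)))
          = q \<alpha> (simplex_param t) / (q \<alpha> (simplex_param (tstar \<alpha>)) * exp (profile (simplex_param t)))"
        using star by eventually_elim simp
      ultimately show "((\<lambda>\<alpha>. q \<alpha> (simplex_param t) / (q \<alpha> (simplex_param (tstar \<alpha>)) * limit_profile b \<beta> t)) \<longlongrightarrow> 1) (at_right 0)"
        using Lim_transform_eventually[OF asym(2)[OF u]] by simp
    qed
  qed
qed

end
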